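(* Let $(M,h)$ be a pseudo-Riemannian manifold and $\nabla$ an affine connection on $M$. Let $h^H$ be the horizontal lift metric of $h$ on $TM$ with respect to $\nabla$, and let $\bar J^\nabla_\mp$ be the $(1,1)$-tensor fields on $TM$ determined by $\bar J^\nabla_\mp(X^H)=X^V$ and $\bar J^\nabla_\mp(X^V)=\mp X^H$ for all vector fields $X$ on $M$. Then $(TM,\bar J^\nabla_-,h^H)$ is a Norden manifold and $(TM,\bar J^\nabla_+,h^H)$ is an almost Para-Norden manifold.
   Context: $\nabla$ may have torsion. With coordinates $(\tilde x^i,y^i)$ on $TM$ induced by coordinates $(x^i)$ on $M$ and $\nabla_{\partial/\partial x^i}\partial/\partial x^j=\Gamma^k_{ij}\partial/\partial x^k$, the horizontal lift of $X=X^i\partial/\partial x^i$ is $X^H=X^i\big(\partial/\partial\tilde x^i-y^k\Gamma^l_{ik}\,\partial/\partial y^l\big)$ and its vertical lift is $X^V=X^i\partial/\partial y^i$. (The tensors $\bar J^\nabla_\mp$ are the conjugates by $\Psi^\nabla(X+\alpha)=X^H+(h^{-1}(\alpha))^V$ of the endomorphisms $\hat J_\mp(X+\alpha)=\mp h^{-1}(\alpha)+h(X)$ of $TM\oplus T^*M$, where $h(X)=h(X,\cdot)$.) The horizontal lift metric $h^H$ on $TM$ is given by $h^H(X^H,Y^H)=0$, $h^H(X^V,Y^V)=0$, $h^H(X^H,Y^V)=h^H(Y^V,X^H)=h(X,Y)$. A Norden manifold $(N,J,g)$ is an almost complex manifold $(N,J)$ with a pseudo-Riemannian metric $g$ such that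 $J$ is $g$-symmetric ($g(JA,B)=g(A,JB)$). An almost Para-Norden manifold $(N,J,g)$ is an even-dimensional manifold $N$ with a pseudo-Riemannian metric $g$ and a $(1,1)$-tensor field $J$ with $J^2=I$, whose $+1$ and $-1$ eigenbundles have equal rank, and such that $J$ is $g$-symmetric. *)

theory Defs
  imports "HOL-Analysis.Analysis" "HOL-Library.Function_Algebras"
begin

text \<open>Tangent vectors and vector fields are functions, with pointwise vector space operations.\<close>

instantiation "fun" :: (type, real_vector) real_vector
begin
definition scaleR_fun_def: "a *\<^sub>R f = (\<lambda>x. a *\<^sub>R f x)"
instance
  by standard (simp_all add: scaleR_fun_def fun_eq_iff scaleR_add_right scaleR_add_left)
end

lemma scaleR_fun_apply [simp]: "(a *\<^sub>R f) x = a *\<^sub>R f x"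
  by (simp add: scaleR_fun_def)


section \<open>Smooth manifolds\<close>

text \<open>\<open>Ck_on k S f\<close> is only meant for open \<open>S\<close>: all iterated directional derivatives of \<open>f\<close> of
  order at most \<open>k\<close> exist and are continuous on \<open>S\<close>.\<close>

primrec Ck_on :: "nat \<Rightarrow> 'e::euclidean_space set \<Rightarrow> ('e \<Rightarrow> 'f::real_normed_vector) \<Rightarrow> bool" where
  "Ck_on 0 S f \<longleftrightarrow> continuous_on S f"
| "Ck_on (Suc k) S f \<longleftrightarrow> (\<forall>x\<in>S. f differentiable (at x)) \<and>
     (\<forall>v. Ck_on k S (\<lambda>x. frechet_derivative f (at x) v))"

definition smooth_on :: "'e::euclidean_space set \<Rightarrow> ('e \<Rightarrow> 'f::real_normed_vector) \<Rightarrow> bool" where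
  "smooth_on S f \<longleftrightarrow> (\<forall>k. Ck_on k S f)"

text \<open>A chart is a pair of a domain and a coordinate map (irrelevant off the domain). A manifold
  is given by an atlas, not required to be maximal; its underlying set is the union of the chart
  domains and its topology is the one that makes all charts homeomorphisms onto open sets.\<close>

type_synonym ('a, 'e) chart = "'a set \<times> ('a \<Rightarrow> 'e)"
type_synonym ('a, 'e) tvec = "('a, 'e) chart \<Rightarrow> 'e"

definition cinv :: "('a, 'e) chart \<Rightarrow> 'e \<Rightarrow> 'a" where
  "cinv c = inv_into (fst c) (snd c)"

definition cimg :: "('a, 'e) chart \<Rightarrow> 'e set" where
  "cimg c = snd c ` fst c"

definition points :: "('a, 'e) chart set \<Rightarrow> 'a set" where
  "points A = (\<Union>c\<in>A. fst c)"

definition charts_at :: "('a, 'e) chart set \<Rightarrow> 'a \<Rightarrow> ('a, 'e) chart set" where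
  "charts_at A p = {c \<in> A. p \<in> fst c}"

definition smooth_atlas :: "('a, 'e::euclidean_space) chart set \<Rightarrow> bool" where
  "smooth_atlas A \<longleftrightarrow>
     (\<forall>c\<in>A. inj_on (snd c) (fst c) \<and> open (cimg c)) \<and>
     (\<forall>c\<in>A. \<forall>d\<in>A. open (snd c ` (fst c \<inter> fst d)) \<and>
        smooth_on (snd c ` (fst c \<inter> fst d)) (snd d \<circ> cinv c))"

definition mtopology :: "('a, 'e::euclidean_space) chart set \<Rightarrow> 'a topology" where
  "mtopology A = topology (\<lambda>W. W \<subseteq> points A \<and> (\<forall>c\<in>A. open (snd c ` (W \<inter> fst c))))"

definition smooth_manifold :: "('a, 'e::euclidean_space) chart set \<Rightarrow> bool" where
  "smooth_manifold A \<longleftrightarrow>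
     smooth_atlas A \<and> Hausdorff_space (mtopology A) \<and> second_countable (mtopology A)"

definition smooth_fun :: "('a, 'e::euclidean_space) chart set \<Rightarrow> ('a \<Rightarrow> real) \<Rightarrow> bool" where
  "smooth_fun A f \<longleftrightarrow> (\<forall>c\<in>A. smooth_on (cimg c) (f \<circ> cinv c))"


section \<open>Tangent vectors and tensor fields\<close>

text \<open>A tangent vector at \<open>p\<close> assigns to each chart around \<open>p\<close> its component vector in that chart,
  subject to the usual transformation law; it is \<open>0\<close> on the other charts. All fields below
  are likewise extended by \<open>0\<close>, so that equality of fields is equality of functions.\<close>

definition tangent_space :: "('a, 'e::euclidean_space) chart set \<Rightarrow> 'a \<Rightarrow> ('a, 'e) tvec set" where
  "tangent_space A p = {v.
     (\<forall>c. c \<notin> charts_at A p \<longrightarrow> v c = 0) \<and>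
     (\<forall>c\<in>charts_at A p. \<forall>d\<in>charts_at A p.
        v d = frechet_derivative (snd d \<circ> cinv c) (at (snd c p)) (v c))}"

text \<open>\<open>coord_vec A c p w\<close> is the tangent vector at \<open>p\<close> with components \<open>w\<close> in the chart \<open>c\<close>; for a
  basis vector \<open>w\<close> this is the coordinate vector of the corresponding coordinate.\<close>

definition coord_vec :: "('a, 'e::euclidean_space) chart set \<Rightarrow> ('a, 'e) chart \<Rightarrow> 'a \<Rightarrow> 'e \<Rightarrow> ('a, 'e) tvec" where
  "coord_vec A c p w = (\<lambda>d. if d \<in> charts_at A p
     then frechet_derivative (snd d \<circ> cinv c) (at (snd c p)) w else 0)"

definition vector_field :: "('a, 'e::euclidean_space) chart set \<Rightarrow> ('a \<Rightarrow> ('a, 'e) tvec) \<Rightarrow> bool" where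
  "vector_field A X \<longleftrightarrow>
     (\<forall>p\<in>points A. X p \<in> tangent_space A p) \<and>
     (\<forall>p. p \<notin> points A \<longrightarrow> X p = 0) \<and>
     (\<forall>c\<in>A. smooth_on (cimg c) (\<lambda>x. X (cinv c x) c))"

definition tensor_field_11 ::
  "('a, 'e::euclidean_space) chart set \<Rightarrow> ('a \<Rightarrow> ('a, 'e) tvec \<Rightarrow> ('a, 'e) tvec) \<Rightarrow> bool" where
  "tensor_field_11 A J \<longleftrightarrow>
     (\<forall>p\<in>points A. \<forall>v\<in>tangent_space A p. J p v \<in> tangent_space A p) \<and>
     (\<forall>p\<in>points A. \<forall>v\<in>tangent_space A p. \<forall>w\<in>tangent_space A p. \<forall>a b.
        J p (a *\<^sub>R v + b *\<^sub>R w) = a *\<^sub>R J p v + b *\<^sub>R J p w) \<and>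
     (\<forall>p v. p \<notin> points A \<or> v \<notin> tangent_space A p \<longrightarrow> J p v = 0) \<and>
     (\<forall>c\<in>A. \<forall>w. smooth_on (cimg c) (\<lambda>x. J (cinv c x) (coord_vec A c (cinv c x) w) c))"

definition tensor_field_02 ::
  "('a, 'e::euclidean_space) chart set \<Rightarrow> ('a \<Rightarrow> ('a, 'e) tvec \<Rightarrow> ('a, 'e) tvec \<Rightarrow> real) \<Rightarrow> bool" where
  "tensor_field_02 A g \<longleftrightarrow>
     (\<forall>p\<in>points A. \<forall>u\<in>tangent_space A p. \<forall>v\<in>tangent_space A p. \<forall>w\<in>tangent_space A p. \<forall>a b.
        g p (a *\<^sub>R u + b *\<^sub>R v) w = a * g p u w + b * g p v w \<and>
        g p w (a *\<^sub>R u + b *\<^sub>R v) = a * g p w u + b * g p w v) \<and>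
     (\<forall>p v w. p \<notin> points A \<or> v \<notin> tangent_space A p \<or> w \<notin> tangent_space A p \<longrightarrow> g p v w = 0) \<and>
     (\<forall>c\<in>A. \<forall>v w. smooth_on (cimg c)
        (\<lambda>x. g (cinv c x) (coord_vec A c (cinv c x) v) (coord_vec A c (cinv c x) w)))"


section \<open>Pseudo-Riemannian, Norden and almost Para-Norden manifolds\<close>

definition metric_index ::
  "('a, 'e::euclidean_space) chart set \<Rightarrow> ('a \<Rightarrow> ('a, 'e) tvec \<Rightarrow> ('a, 'e) tvec \<Rightarrow> real) \<Rightarrow> 'a \<Rightarrow> nat" where
  "metric_index A g p = Max {dim W |W. subspace W \<and> W \<subseteq> tangent_space A p \<and>
     (\<forall>v\<in>W. v \<noteq> 0 \<longrightarrow> g p v v < 0)}"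

text \<open>The index is required to be the same at all points, also when the manifold is disconnected.\<close>

definition pseudo_riemannian_manifold ::
  "('a, 'e::euclidean_space) chart set \<Rightarrow> ('a \<Rightarrow> ('a, 'e) tvec \<Rightarrow> ('a, 'e) tvec \<Rightarrow> real) \<Rightarrow> bool" where
  "pseudo_riemannian_manifold A g \<longleftrightarrow>
     smooth_manifold A \<and> tensor_field_02 A g \<and>
     (\<forall>p\<in>points A. \<forall>v\<in>tangent_space A p. \<forall>w\<in>tangent_space A p. g p v w = g p w v) \<and>
     (\<forall>p\<in>points A. \<forall>v\<in>tangent_space A p. (\<forall>w\<in>tangent_space A p. g p v w = 0) \<longrightarrow> v = 0) \<and>
     (\<exists>k. \<forall>p\<in>points A. metric_index A g p = k)"

definition almost_complex_manifold ::
  "('a, 'e::euclidean_space) chart set \<Rightarrow> ('a \<Rightarrow> ('a, 'e) tvec \<Rightarrow> ('a, 'e) tvec) \<Rightarrow> bool" where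
  "almost_complex_manifold A J \<longleftrightarrow>
     smooth_manifold A \<and> tensor_field_11 A J \<and>
     (\<forall>p\<in>points A. \<forall>v\<in>tangent_space A p. J p (J p v) = - v)"

definition metric_symmetric ::
  "('a, 'e::euclidean_space) chart set \<Rightarrow> ('a \<Rightarrow> ('a, 'e) tvec \<Rightarrow> ('a, 'e) tvec) \<Rightarrow>
   ('a \<Rightarrow> ('a, 'e) tvec \<Rightarrow> ('a, 'e) tvec \<Rightarrow> real) \<Rightarrow> bool" where
  "metric_symmetric A J g \<longleftrightarrow>
     (\<forall>p\<in>points A. \<forall>v\<in>tangent_space A p. \<forall>w\<in>tangent_space A p. g p (J p v) w = g p v (J p w))"

definition norden_manifold ::
  "('a, 'e::euclidean_space) chart set \<Rightarrow> ('a \<Rightarrow> ('a, 'e) tvec \<Rightarrow> ('a, 'e) tvec) \<Rightarrow>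
   ('a \<Rightarrow> ('a, 'e) tvec \<Rightarrow> ('a, 'e) tvec \<Rightarrow> real) \<Rightarrow> bool" where
  "norden_manifold A J g \<longleftrightarrow>
     almost_complex_manifold A J \<and> pseudo_riemannian_manifold A g \<and> metric_symmetric A J g"

definition almost_para_norden_manifold ::
  "('a, 'e::euclidean_space) chart set \<Rightarrow> ('a \<Rightarrow> ('a, 'e) tvec \<Rightarrow> ('a, 'e) tvec) \<Rightarrow>
   ('a \<Rightarrow> ('a, 'e) tvec \<Rightarrow> ('a, 'e) tvec \<Rightarrow> real) \<Rightarrow> bool" where
  "almost_para_norden_manifold A J g \<longleftrightarrow>
     even DIM('e) \<and> pseudo_riemannian_manifold A g \<and> tensor_field_11 A J \<and>
     (\<forall>p\<in>points A. \<forall>v\<in>tangent_space A p. J p (J p v) = v) \<and>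
     (\<forall>p\<in>points A. dim {v \<in> tangent_space A p. J p v = v} = dim {v \<in> tangent_space A p. J p v = - v}) \<and>
     metric_symmetric A J g"


section \<open>Affine connections\<close>

text \<open>The last conjunct is the Leibniz rule; \<open>X f\<close> is computed in an arbitrary chart. Additivity in
  \<open>Y\<close> together with the Leibniz rule for constant \<open>f\<close> gives linearity over the reals.\<close>

definition affine_connection ::
  "('a, 'e::euclidean_space) chart set \<Rightarrow>
   (('a \<Rightarrow> ('a, 'e) tvec) \<Rightarrow> ('a \<Rightarrow> ('a, 'e) tvec) \<Rightarrow> ('a \<Rightarrow> ('a, 'e) tvec)) \<Rightarrow> bool" where
  "affine_connection A D \<longleftrightarrow>
     (\<forall>X Y. vector_field A X \<and> vector_field A Y \<longrightarrow> vector_field A (D X Y)) \<and>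
     (\<forall>X X' Y. vector_field A X \<and> vector_field A X' \<and> vector_field A Y \<longrightarrow>
        D (X + X') Y = D X Y + D X' Y) \<and>
     (\<forall>X Y Y'. vector_field A X \<and> vector_field A Y \<and> vector_field A Y' \<longrightarrow>
        D X (Y + Y') = D X Y + D X Y') \<and>
     (\<forall>f X Y. smooth_fun A f \<and> vector_field A X \<and> vector_field A Y \<longrightarrow>
        D (\<lambda>p. f p *\<^sub>R X p) Y = (\<lambda>p. f p *\<^sub>R D X Y p)) \<and>
     (\<forall>f X Y. smooth_fun A f \<and> vector_field A X \<and> vector_field A Y \<longrightarrow>
        (\<forall>p\<in>points A. \<forall>c\<in>charts_at A p.
           D X (\<lambda>q. f q *\<^sub>R Y q) p =
             f p *\<^sub>R D X Y p + frechet_derivative (f \<circ> cinv c) (at (snd c p)) (X p c) *\<^sub>R Y p))"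

text \<open>The coordinate fields of a chart \<open>c\<close> are only defined on its domain. As a connection is local,
  its value on them at \<open>p\<close> is its value on any global fields agreeing with them near \<open>p\<close>. The
  coordinate indices are the elements of \<open>Basis\<close>, and \<open>christoffel A D c k i j p\<close> is the
  \<open>k\<close>-th component at \<open>p\<close> of the derivative of the \<open>j\<close>-th coordinate field along the \<open>i\<close>-th one.\<close>

definition christoffel ::
  "('a, 'e::euclidean_space) chart set \<Rightarrow>
   (('a \<Rightarrow> ('a, 'e) tvec) \<Rightarrow> ('a \<Rightarrow> ('a, 'e) tvec) \<Rightarrow> ('a \<Rightarrow> ('a, 'e) tvec)) \<Rightarrow>
   ('a, 'e) chart \<Rightarrow> 'e \<Rightarrow> 'e \<Rightarrow> 'e \<Rightarrow> 'a \<Rightarrow> real" where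
  "christoffel A D c k i j p = (THE z. \<forall>X Y. vector_field A X \<and> vector_field A Y \<and>
     (\<exists>W. openin (mtopology A) W \<and> p \<in> W \<and> W \<subseteq> fst c \<and>
        (\<forall>q\<in>W. X q = coord_vec A c q i \<and> Y q = coord_vec A c q j)) \<longrightarrow>
     z = D X Y p c \<bullet> k)"


section \<open>The tangent bundle and its lifts\<close>

text \<open>The chart of the tangent bundle with the coordinates \<open>(x, y)\<close> induced by \<open>c\<close>.\<close>

definition tchart :: "('a, 'e::euclidean_space) chart set \<Rightarrow> ('a, 'e) chart \<Rightarrow>
    ('a \<times> ('a, 'e) tvec, 'e \<times> 'e) chart" where
  "tchart A c = ({(p, v). p \<in> fst c \<and> v \<in> tangent_space A p}, (\<lambda>(p, v). (snd c p, v c)))"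

definition tangent_bundle :: "('a, 'e::euclidean_space) chart set \<Rightarrow>
    ('a \<times> ('a, 'e) tvec, 'e \<times> 'e) chart set" where
  "tangent_bundle A = tchart A ` A"

text \<open>The vector field on the tangent bundle whose components at \<open>P\<close> in the induced coordinates of
  each chart \<open>c\<close> are \<open>Z c P\<close>.\<close>

definition bundle_field :: "('a, 'e::euclidean_space) chart set \<Rightarrow>
    (('a, 'e) chart \<Rightarrow> 'a \<times> ('a, 'e) tvec \<Rightarrow> 'e \<times> 'e) \<Rightarrow>
    'a \<times> ('a, 'e) tvec \<Rightarrow> ('a \<times> ('a, 'e) tvec, 'e \<times> 'e) tvec" where
  "bundle_field A Z P = (if P \<in> points (tangent_bundle A)
     then THE V. V \<in> tangent_space (tangent_bundle A) P \<and>
            (\<forall>c\<in>charts_at A (fst P). V (tchart A c) = Z c P)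
     else 0)"

definition hlift ::
  "('a, 'e::euclidean_space) chart set \<Rightarrow>
   (('a \<Rightarrow> ('a, 'e) tvec) \<Rightarrow> ('a \<Rightarrow> ('a, 'e) tvec) \<Rightarrow> ('a \<Rightarrow> ('a, 'e) tvec)) \<Rightarrow>
   ('a \<Rightarrow> ('a, 'e) tvec) \<Rightarrow> 'a \<times> ('a, 'e) tvec \<Rightarrow> ('a \<times> ('a, 'e) tvec, 'e \<times> 'e) tvec" where
  "hlift A D X = bundle_field A (\<lambda>c (p, y).
     (X p c, - (\<Sum>l\<in>Basis. \<Sum>i\<in>Basis. \<Sum>k\<in>Basis.
        ((X p c \<bullet> i) * (y c \<bullet> k) * christoffel A D c l i k p) *\<^sub>R l)))"

definition vlift ::
  "('a, 'e::euclidean_space) chart set \<Rightarrow>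
   ('a \<Rightarrow> ('a, 'e) tvec) \<Rightarrow> 'a \<times> ('a, 'e) tvec \<Rightarrow> ('a \<times> ('a, 'e) tvec, 'e \<times> 'e) tvec" where
  "vlift A X = bundle_field A (\<lambda>c (p, y). (0, X p c))"

definition hlift_metric ::
  "('a, 'e::euclidean_space) chart set \<Rightarrow>
   (('a \<Rightarrow> ('a, 'e) tvec) \<Rightarrow> ('a \<Rightarrow> ('a, 'e) tvec) \<Rightarrow> ('a \<Rightarrow> ('a, 'e) tvec)) \<Rightarrow>
   ('a \<Rightarrow> ('a, 'e) tvec \<Rightarrow> ('a, 'e) tvec \<Rightarrow> real) \<Rightarrow>
   'a \<times> ('a, 'e) tvec \<Rightarrow> ('a \<times> ('a, 'e) tvec, 'e \<times> 'e) tvec \<Rightarrow>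
   ('a \<times> ('a, 'e) tvec, 'e \<times> 'e) tvec \<Rightarrow> real" where
  "hlift_metric A D h = (THE G. tensor_field_02 (tangent_bundle A) G \<and>
     (\<forall>X Y. vector_field A X \<and> vector_field A Y \<longrightarrow> (\<forall>P\<in>points (tangent_bundle A).
        G P (hlift A D X P) (hlift A D Y P) = 0 \<and>
        G P (vlift A X P) (vlift A Y P) = 0 \<and>
        G P (hlift A D X P) (vlift A Y P) = h (fst P) (X (fst P)) (Y (fst P)) \<and>
        G P (vlift A Y P) (hlift A D X P) = h (fst P) (X (fst P)) (Y (fst P)))))"

text \<open>The tensor field sending each \<open>X\<^sup>H\<close> to \<open>X\<^sup>V\<close> and each \<open>X\<^sup>V\<close> to \<open>s X\<^sup>H\<close>.\<close>

definition lift_structure ::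
  "real \<Rightarrow> ('a, 'e::euclidean_space) chart set \<Rightarrow>
   (('a \<Rightarrow> ('a, 'e) tvec) \<Rightarrow> ('a \<Rightarrow> ('a, 'e) tvec) \<Rightarrow> ('a \<Rightarrow> ('a, 'e) tvec)) \<Rightarrow>
   'a \<times> ('a, 'e) tvec \<Rightarrow> ('a \<times> ('a, 'e) tvec, 'e \<times> 'e) tvec \<Rightarrow>
   ('a \<times> ('a, 'e) tvec, 'e \<times> 'e) tvec" where
  "lift_structure s A D = (THE J. tensor_field_11 (tangent_bundle A) J \<and>
     (\<forall>X. vector_field A X \<longrightarrow> (\<forall>P\<in>points (tangent_bundle A).
        J P (hlift A D X P) = vlift A X P \<and>
        J P (vlift A X P) = s *\<^sub>R hlift A D X P)))"

abbreviation "Jbar_minus \<equiv> lift_structure (- 1)"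
abbreviation "Jbar_plus \<equiv> lift_structure 1"

end

theory Submission
  imports Defs
begin

text \<open>In induced coordinates \<open>(x, y)\<close>, a tangent vector \<open>(a, b)\<close> of the tangent bundle at \<open>(p, y)\<close> is
  determined by its projection \<open>a\<close> and its image \<open>b + \<Gamma>(a, y)\<close> under the connection map. The
  transformation law of the Christoffel symbols says exactly that both are tangent vectors of the base,
  so every tangent space of the bundle is a direct sum \<open>T\<^sub>p \<oplus> T\<^sub>p\<close> in which the horizontal and vertical
  lifts of \<open>X\<close> are \<open>(X, 0)\<close> and \<open>(0, X)\<close>. There the structures read \<open>(u, w) \<mapsto> (s w, u)\<close> and
  \<open>((u, w), (u', w')) \<mapsto> h(u, w') + h(w, u')\<close>, and the algebraic claims are immediate. The metric is
  neutral: the vertical subspace is isotropic of half the dimension, and \<open>(u, - S u)\<close> spans a negative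
  definite complement when \<open>h(u, S u)\<close> is a squared Euclidean norm.\<close>

section \<open>Calculus of smooth maps\<close>

text \<open>The obstacle is that the lifted objects are given by definite descriptions: the lifts by
  their components in all induced charts, the metric and the endomorphisms by their values on lifts
  of global fields, the Christoffel symbols by global fields that agree with coordinate fields near
  a point. Existence comes from explicit formulas through \<open>lift\<close>. Uniqueness of the
  tensors requires a global field through every tangent vector of the base. Such fields are bump
  functions times coordinate fields, extended by zero, and the Hausdorff property makes the
  extension smooth.

  The transformation law of the Christoffel symbols is not computed by a change of frame. It is read
  off from the fact that the derivative of one global field along another is again a vector field:
  its components in two charts are compared, and the derivatives of the field components are related
  by differentiating the transformation law of the field.\<close>

lemma frechet_derivative_cong_open:
  assumes "open S" "x \<in> S" "\<And>y. y \<in> S \<Longrightarrow> f y = g y"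
  shows "frechet_derivative f (at x) = frechet_derivative g (at x)"
proof -
  have "(f has_derivative f') (at x) \<longleftrightarrow> (g has_derivative f') (at x)" for f'
    using assms has_derivative_transform_within_open[OF _ assms(1,2)] by metis
  then show ?thesis
    by (simp add: frechet_derivative_def)
qed

lemma differentiable_cong_open:
  assumes "open S" "x \<in> S" "\<And>y. y \<in> S \<Longrightarrow> f y = g y" "f differentiable (at x)"
  shows "g differentiable (at x)"
  using assms has_derivative_transform_within_open[OF _ assms(1,2)] unfolding differentiable_def by metis

lemma Ck_on_cong:
  assumes "open S" "\<And>x. x \<in> S \<Longrightarrow> f x = g x" "Ck_on k S f"
  shows "Ck_on k S g"
  using assms(2,3)
proof (induction k arbitrary: f g)
  case 0
  then show ?case by (auto cong: continuous_on_cong)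
next
  case (Suc k)
  have "Ck_on k S (\<lambda>x. frechet_derivative g (at x) v)" for v
  proof (rule Suc.IH)
    show "frechet_derivative f (at x) v = frechet_derivative g (at x) v" if "x \<in> S" for x
      by (metis Suc.prems(1) assms(1) frechet_derivative_cong_open that)
  qed (use Suc.prems in simp)
  moreover have "g differentiable (at x)" if "x \<in> S" for x
    using differentiable_cong_open[OF assms(1) that, of f g] Suc.prems that by auto
  ultimately show ?case by simp
qed

lemma Ck_on_subset: "Ck_on k S f \<Longrightarrow> T \<subseteq> S \<Longrightarrow> Ck_on k T f"
  by (induction k arbitrary: f) (auto intro: continuous_on_subset)

text \<open>Differentiability is required at each point separately, and continuity on an open set is
  continuity at each of its points, so every clause of \<open>Ck_on\<close> can be checked on a
  neighbourhood.\<close>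

lemma Ck_on_local:
  assumes "\<And>x. x \<in> S \<Longrightarrow> \<exists>T. open T \<and> x \<in> T \<and> Ck_on k T f"
  shows "Ck_on k S f"
  using assms
proof (induction k arbitrary: f)
  case 0
  then show ?case
    by (metis Ck_on.simps(1) continuous_at_imp_continuous_on continuous_on_eq_continuous_at)
next
  case (Suc k)
  then show ?case by (auto; metis)
qed

text \<open>Allows the derivative to be supplied by any formula. The closure lemmas below pass the
  sum, product or chain rule here and then apply the induction hypothesis to the resulting
  formula.\<close>

lemma Ck_on_SucI:
  assumes "open S" "\<And>x. x \<in> S \<Longrightarrow> (f has_derivative f' x) (at x)" "\<And>v. Ck_on k S (\<lambda>x. f' x v)"
  shows "Ck_on (Suc k) S f"
proof -
  have "Ck_on k S (\<lambda>x. frechet_derivative f (at x) v)" for v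
    by (rule Ck_on_cong[OF assms(1) _ assms(3)]) (simp add: frechet_derivative_at[OF assms(2), symmetric])
  then show ?thesis
    using assms(2) by (auto simp: differentiable_def)
qed

lemma Ck_on_Suc_deriv:
  "Ck_on (Suc k) S f \<Longrightarrow> x \<in> S \<Longrightarrow> (f has_derivative frechet_derivative f (at x)) (at x)"
  by (simp add: frechet_derivative_works)

lemma Ck_on_lower: "Ck_on (Suc k) S f \<Longrightarrow> Ck_on k S f"
proof (induction k arbitrary: f)
  case 0
  then show ?case
    by (simp add: continuous_at_imp_continuous_on differentiable_imp_continuous_within)
next
  case (Suc k)
  then show ?case by auto
qed

lemma Ck_on_const [intro]: "Ck_on k S (\<lambda>x. a)"
  by (induction k arbitrary: a) (auto)

lemma Ck_on_add:
  assumes "open S"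
  shows "Ck_on k S f \<Longrightarrow> Ck_on k S g \<Longrightarrow> Ck_on k S (\<lambda>x. f x + g x)"
proof (induction k arbitrary: f g)
  case (Suc k)
  show ?case
    by (rule Ck_on_SucI[OF assms has_derivative_add[OF Ck_on_Suc_deriv Ck_on_Suc_deriv]])
      (use Suc in auto)
qed (auto intro: continuous_intros)

lemma Ck_on_linear:
  assumes "open S" "bounded_linear L"
  shows "Ck_on k S f \<Longrightarrow> Ck_on k S (\<lambda>x. L (f x))"
proof (induction k arbitrary: f)
  case (Suc k)
  show ?case
    by (rule Ck_on_SucI[OF assms(1) bounded_linear.has_derivative[OF assms(2) Ck_on_Suc_deriv]])
      (use Suc in auto)
qed (use assms in \<open>auto intro: bounded_linear.continuous_on\<close>)

lemma Ck_on_bilinear: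
  assumes "open S" "bounded_bilinear B"
  shows "Ck_on k S f \<Longrightarrow> Ck_on k S g \<Longrightarrow> Ck_on k S (\<lambda>x. B (f x) (g x))"
proof (induction k arbitrary: f g)
  case 0
  then show ?case using assms(2) by (auto intro: bounded_bilinear.continuous_on)
next
  case (Suc k)
  note D = bounded_bilinear.FDERIV[OF assms(2) Ck_on_Suc_deriv[OF Suc.prems(1)] Ck_on_Suc_deriv[OF Suc.prems(2)]]
  show ?case
    by (rule Ck_on_SucI[OF assms(1) D], assumption, assumption,
        intro Ck_on_add[OF assms(1)] Suc.IH)
      (use Suc.prems Ck_on_lower in simp_all)
qed

lemma Ck_on_sum:
  assumes "open S"
  shows "(\<And>i. i \<in> I \<Longrightarrow> Ck_on k S (f i)) \<Longrightarrow> Ck_on k S (\<lambda>x. \<Sum>i\<in>I. f i x)"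
  by (induction I rule: infinite_finite_induct) (auto intro: Ck_on_add[OF assms])

lemma linear_expand:
  fixes L :: "'e::euclidean_space \<Rightarrow> 'f::real_vector"
  assumes "linear L"
  shows "L w = (\<Sum>b\<in>Basis. (w \<bullet> b) *\<^sub>R L b)"
proof -
  have "L w = L (\<Sum>b\<in>Basis. (w \<bullet> b) *\<^sub>R b)"
    by (simp add: euclidean_representation)
  also have "\<dots> = (\<Sum>b\<in>Basis. (w \<bullet> b) *\<^sub>R L b)"
    by (simp add: linear_sum[OF assms] linear_scale[OF assms])
  finally show ?thesis .
qed

text \<open>In the chain rule both the linear map and the vector it acts on vary with
  \<open>x\<close>, while the induction hypothesis covers the derivative of \<open>g\<close> only in
  a fixed direction. Expanding the vector in the basis turns the derivative into a finite sum of
  products of functions that are already covered.\<close>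

lemma Ck_on_compose:
  fixes f :: "'e::euclidean_space \<Rightarrow> 'f::euclidean_space" and g :: "'f \<Rightarrow> 'g::real_normed_vector"
  assumes "open S" "open T" "f ` S \<subseteq> T"
  shows "Ck_on k S f \<Longrightarrow> Ck_on k T g \<Longrightarrow> Ck_on k S (\<lambda>x. g (f x))"
  using assms(3)
proof (induction k arbitrary: g)
  case 0
  then show ?case by (auto intro: continuous_on_compose2)
next
  case (Suc k)
  let ?Df = "\<lambda>x. frechet_derivative f (at x)" and ?Dg = "\<lambda>x. frechet_derivative g (at x)"
  have D: "((\<lambda>x. g (f x)) has_derivative (\<lambda>v. \<Sum>b\<in>Basis. (?Df x v \<bullet> b) *\<^sub>R ?Dg (f x) b)) (at x)"
    if "x \<in> S" for x
  proof -
    have fx: "f x \<in> T" using that Suc.prems by auto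
    have g: "(g has_derivative ?Dg (f x)) (at (f x))"
      using Ck_on_Suc_deriv[OF Suc.prems(2) fx] .
    show ?thesis
      by (rule has_derivative_eq_rhs[OF has_derivative_compose[OF Ck_on_Suc_deriv[OF Suc.prems(1) that] g]])
        (rule ext, rule linear_expand[OF has_derivative_linear[OF g]])
  qed
  show ?case
  proof (rule Ck_on_SucI[OF assms(1) D])
    fix v
    have "Ck_on k S (\<lambda>x. ?Dg (f x) b)" for b
      using Suc.IH[OF Ck_on_lower[OF Suc.prems(1)], of "\<lambda>y. ?Dg y b"] Suc.prems by simp
    moreover have "Ck_on k S (\<lambda>x. ?Df x v \<bullet> b)" for b
      using Suc.prems by (intro Ck_on_linear[OF assms(1) bounded_linear_inner_left]) auto
    ultimately show "Ck_on k S (\<lambda>x. \<Sum>b\<in>Basis. (?Df x v \<bullet> b) *\<^sub>R ?Dg (f x) b)"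
      by (intro Ck_on_sum[OF assms(1)] Ck_on_bilinear[OF assms(1) bounded_bilinear_scaleR])
  qed
qed

section \<open>Closure properties of smooth functions\<close>

lemma smooth_on_cong:
  "open S \<Longrightarrow> (\<And>x. x \<in> S \<Longrightarrow> f x = g x) \<Longrightarrow> smooth_on S f \<Longrightarrow> smooth_on S g"
  unfolding smooth_on_def using Ck_on_cong by blast

lemma smooth_on_subset: "smooth_on S f \<Longrightarrow> T \<subseteq> S \<Longrightarrow> smooth_on T f"
  unfolding smooth_on_def using Ck_on_subset by blast

lemma smooth_on_local:
  "(\<And>x. x \<in> S \<Longrightarrow> \<exists>T. open T \<and> x \<in> T \<and> smooth_on T f) \<Longrightarrow> smooth_on S f"
  unfolding smooth_on_def by (metis Ck_on_local)

lemma smooth_on_differentiable: "smooth_on S f \<Longrightarrow> x \<in> S \<Longrightarrow> f differentiable (at x)"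
  unfolding smooth_on_def by (metis Ck_on.simps(2))

lemma smooth_on_continuous_on: "smooth_on S f \<Longrightarrow> continuous_on S f"
  unfolding smooth_on_def by (metis Ck_on.simps(1))

lemma smooth_on_deriv: "smooth_on S f \<Longrightarrow> smooth_on S (\<lambda>x. frechet_derivative f (at x) v)"
  unfolding smooth_on_def by (metis Ck_on.simps(2))

lemma smooth_on_const [intro, simp]: "smooth_on S (\<lambda>x. a)"
  by (simp add: smooth_on_def Ck_on_const)

lemma smooth_on_add: "open S \<Longrightarrow> smooth_on S f \<Longrightarrow> smooth_on S g \<Longrightarrow> smooth_on S (\<lambda>x. f x + g x)"
  unfolding smooth_on_def using Ck_on_add[of S _ f g] by auto

lemma smooth_on_linear:
  "open S \<Longrightarrow> bounded_linear L \<Longrightarrow> smooth_on S f \<Longrightarrow> smooth_on S (\<lambda>x. L (f x))"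
  unfolding smooth_on_def using Ck_on_linear[of S L _ f] by auto

lemma smooth_on_minus: "open S \<Longrightarrow> smooth_on S f \<Longrightarrow> smooth_on S (\<lambda>x. - f x)"
  using smooth_on_linear[OF _ bounded_linear_minus[OF bounded_linear_ident], of S f] by simp

lemma smooth_on_diff: "open S \<Longrightarrow> smooth_on S f \<Longrightarrow> smooth_on S g \<Longrightarrow> smooth_on S (\<lambda>x. f x - g x)"
  using smooth_on_add[of S f "\<lambda>x. - g x"] smooth_on_minus by auto

lemma smooth_on_scaleR:
  "open S \<Longrightarrow> smooth_on S f \<Longrightarrow> smooth_on S g \<Longrightarrow> smooth_on S (\<lambda>x. f x *\<^sub>R g x)"
  unfolding smooth_on_def using Ck_on_bilinear[OF _ bounded_bilinear_scaleR, of S _ f g] by auto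

lemma smooth_on_mult:
  fixes f g :: "'e::euclidean_space \<Rightarrow> real"
  shows "open S \<Longrightarrow> smooth_on S f \<Longrightarrow> smooth_on S g \<Longrightarrow> smooth_on S (\<lambda>x. f x * g x)"
  unfolding smooth_on_def using Ck_on_bilinear[OF _ bounded_bilinear_mult, of S _ f g] by auto

lemma smooth_on_inner:
  "open S \<Longrightarrow> smooth_on S f \<Longrightarrow> smooth_on S g \<Longrightarrow> smooth_on S (\<lambda>x. f x \<bullet> g x)"
  unfolding smooth_on_def using Ck_on_bilinear[OF _ bounded_bilinear_inner, of S _ f g] by auto

lemma smooth_on_sum:
  "open S \<Longrightarrow> (\<And>i. i \<in> I \<Longrightarrow> smooth_on S (f i)) \<Longrightarrow> smooth_on S (\<lambda>x. \<Sum>i\<in>I. f i x)"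
  unfolding smooth_on_def using Ck_on_sum[of S I _ f] by auto

lemma smooth_on_id [intro, simp]: "open S \<Longrightarrow> smooth_on S (\<lambda>x. x)"
  unfolding smooth_on_def
proof
  fix k assume "open S"
  then show "Ck_on k S (\<lambda>x. x)"
    by (cases k) (auto intro!: Ck_on_SucI[where f' = "\<lambda>x v. v"] simp del: Ck_on.simps(2))
qed

lemma smooth_on_compose:
  fixes f :: "'e::euclidean_space \<Rightarrow> 'f::euclidean_space" and g :: "'f \<Rightarrow> 'g::real_normed_vector"
  shows "open S \<Longrightarrow> open T \<Longrightarrow> f ` S \<subseteq> T \<Longrightarrow> smooth_on S f \<Longrightarrow> smooth_on T g \<Longrightarrow> smooth_on S (\<lambda>x. g (f x))"
  unfolding smooth_on_def using Ck_on_compose[of S T f _ g] by auto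

lemma smooth_on_Pair:
  assumes "open S" "smooth_on S f" "smooth_on S g"
  shows "smooth_on S (\<lambda>x. (f x, g x))"
proof -
  have "bounded_linear (\<lambda>y. (y, 0))" "bounded_linear (\<lambda>y. (0, y))"
    by (rule bounded_linear_Pair[OF bounded_linear_ident bounded_linear_zero],
        rule bounded_linear_Pair[OF bounded_linear_zero bounded_linear_ident])
  then have "smooth_on S (\<lambda>x. (f x, 0) + (0, g x))"
    by (intro smooth_on_add[OF assms(1)] smooth_on_linear[OF assms(1) _ assms(2)]
        smooth_on_linear[OF assms(1) _ assms(3)])
  then show ?thesis by simp
qed

lemma smooth_on_fst: "open S \<Longrightarrow> smooth_on S f \<Longrightarrow> smooth_on S (\<lambda>x. fst (f x))"
  using smooth_on_linear[OF _ bounded_linear_fst, of S f] by simp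

lemma smooth_on_snd: "open S \<Longrightarrow> smooth_on S f \<Longrightarrow> smooth_on S (\<lambda>x. snd (f x))"
  using smooth_on_linear[OF _ bounded_linear_snd, of S f] by simp

text \<open>Smoothness of derivatives and tensors is known for constant arguments only. In finite
  dimension a basis expansion extends it to arguments that vary smoothly with the point.\<close>

lemma smooth_on_linear_family:
  fixes L :: "'s::euclidean_space \<Rightarrow> 'e::euclidean_space \<Rightarrow> 'f::real_normed_vector"
  assumes "open S" "\<And>x. x \<in> S \<Longrightarrow> linear (L x)" "\<And>b. smooth_on S (\<lambda>x. L x b)" "smooth_on S w"
  shows "smooth_on S (\<lambda>x. L x (w x))"
proof (rule smooth_on_cong[OF assms(1)])
  show "smooth_on S (\<lambda>x. \<Sum>b\<in>Basis. (w x \<bullet> b) *\<^sub>R L x b)"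
    using assms by (intro smooth_on_sum smooth_on_scaleR smooth_on_inner) auto
qed (rule linear_expand[OF assms(2), symmetric])

subsection \<open>Bump functions\<close>

text \<open>The classical flat function \<open>exp (- 1 / t)\<close>, extended by zero, is the
  member \<open>n = 0\<close>. The powers of \<open>1 / t\<close> are included because derivatives
  of members are linear combinations of members.\<close>

definition expinv :: "nat \<Rightarrow> real \<Rightarrow> real" where
  "expinv n t = (if t > 0 then inverse t ^ n * exp (- inverse t) else 0)"

text \<open>From the right, \<open>1 / t\<close> tends to infinity and the exponential dominates
  every power of it; on the left the function is zero.\<close>

lemma expinv_tendsto: "(expinv n \<longlongrightarrow> 0) (at 0)"
proof -
  have "((\<lambda>x. x ^ n / exp x) \<longlongrightarrow> (0::real)) at_top"
    by (rule tendsto_power_div_exp_0)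
  then have "((\<lambda>t. inverse t ^ n / exp (inverse t)) \<longlongrightarrow> (0::real)) (at_right 0)"
    by (rule filterlim_compose[OF _ filterlim_inverse_at_top_right])
  then have "(expinv n \<longlongrightarrow> 0) (at_right 0)"
    by (rule Lim_transform_eventually)
      (auto simp: eventually_at_right_less expinv_def exp_minus field_simps
        intro!: eventually_mono[OF eventually_at_right_less])
  moreover have "(expinv n \<longlongrightarrow> 0) (at_left 0)"
    by (rule tendsto_eventually)
      (auto simp: expinv_def eventually_at_filter)
  ultimately show ?thesis
    by (simp add: filterlim_split_at)
qed

lemma expinv_deriv:
  "(expinv n has_real_derivative (- real n * expinv (Suc n) t + expinv (Suc (Suc n)) t)) (at t)"
proof (cases t "0::real" rule: linorder_cases)
  case less
  have "((\<lambda>t. 0) has_real_derivative 0) (at t)" by simp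
  then show ?thesis
    using has_field_derivative_transform_within_open[of "\<lambda>t. 0" 0 t "{..<0}" "expinv n"] less
    by (simp add: expinv_def)
next
  case equal
  have "(expinv n has_real_derivative 0) (at 0)"
    unfolding has_field_derivative_iff
  \<comment> \<open>The difference quotient at \<open>0\<close> is itself the next member of the
    family, so its limit is already known.\<close>
  proof (rule Lim_transform_eventually[OF expinv_tendsto[of "Suc n"]])
    show "\<forall>\<^sub>F y in at 0. expinv (Suc n) y = (expinv n y - expinv n 0) / (y - 0)"
      by (auto simp: expinv_def eventually_at_filter field_simps)
  qed
  then show ?thesis using equal by (simp add: expinv_def)
next
  case greater
  have "((\<lambda>t. inverse t ^ n * exp (- inverse t)) has_real_derivative
      (- real n * expinv (Suc n) t + expinv (Suc (Suc n)) t)) (at t)"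
    using greater
    by (auto intro!: derivative_eq_intros simp: expinv_def field_simps power2_eq_square)
      (cases n; simp add: field_simps)
  then show ?thesis
    using has_field_derivative_transform_within_open[of _ _ t "{0<..}" "expinv n"] greater
    by (simp add: expinv_def)
qed

lemma Ck_on_expinv: "Ck_on k UNIV (expinv n)"
proof (induction k arbitrary: n)
  case 0
  show ?case using expinv_deriv
    by (auto intro!: continuous_at_imp_continuous_on DERIV_isCont)
next
  case (Suc k)
  show ?case
  proof (rule Ck_on_SucI[OF open_UNIV])
    show "(expinv n has_derivative (\<lambda>v. (- real n * expinv (Suc n) x + expinv (Suc (Suc n)) x) * v)) (at x)" for x
      using expinv_deriv[of n x] by (simp add: has_field_derivative_def)
    show "Ck_on k UNIV (\<lambda>x. (- real n * expinv (Suc n) x + expinv (Suc (Suc n)) x) * v)" for v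
      by (intro Ck_on_bilinear[OF _ bounded_bilinear_mult] Ck_on_add Suc Ck_on_const) auto
  qed
qed

lemma smooth_on_expinv: "smooth_on UNIV (expinv n)"
  by (simp add: smooth_on_def Ck_on_expinv)

lemma expinv_mono: "s \<le> t \<Longrightarrow> expinv 0 s \<le> expinv 0 t"
  by (auto simp: expinv_def)

lemma bump_exists:
  fixes a :: "'e::euclidean_space"
  assumes "r > 0"
  obtains \<rho> :: "'e \<Rightarrow> real" where "smooth_on UNIV \<rho>" "\<And>x. x \<in> ball a r \<Longrightarrow> \<rho> x = 1"
    "\<And>x. x \<notin> ball a (2 * r) \<Longrightarrow> \<rho> x = 0"
proof -
  let ?e = "expinv 0"
  \<comment> \<open>\<open>u x \<le> 0\<close> on the small ball and \<open>u x \<ge> 1\<close> off the large one; the composite of two copies of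
    \<open>exp (- 1 / t)\<close> is constant on the former and vanishes on the latter, so no quotient of functions is needed.\<close>
  define u where "u = (\<lambda>x::'e. ((x - a) \<bullet> (x - a) - r\<^sup>2) * inverse (3 * r\<^sup>2))"
  define \<rho> where "\<rho> = (\<lambda>x. ?e (?e 1 + - 1 * ?e (u x)) * inverse (?e (?e 1)))"
  have u: "smooth_on UNIV u"
    unfolding u_def by (intro smooth_on_mult smooth_on_diff smooth_on_inner smooth_on_id smooth_on_const) auto
  have "smooth_on UNIV (\<lambda>x. ?e (u x))"
    by (rule smooth_on_compose[OF _ _ _ u smooth_on_expinv]) auto
  then have "smooth_on UNIV (\<lambda>x. ?e 1 + - 1 * ?e (u x))"
    by (intro smooth_on_add smooth_on_mult smooth_on_const) auto
  then have "smooth_on UNIV (\<lambda>x. ?e (?e 1 + - 1 * ?e (u x)))"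
    by (intro smooth_on_compose[OF _ _ _ _ smooth_on_expinv]) auto
  then have "smooth_on UNIV \<rho>"
    unfolding \<rho>_def by (intro smooth_on_mult smooth_on_const) auto
  moreover have "\<rho> x = 1" if "x \<in> ball a r" for x
  proof -
    have "(norm (x - a))\<^sup>2 \<le> r\<^sup>2"
      using that by (intro power_mono) (auto simp: dist_norm norm_minus_commute)
    then have "u x \<le> 0"
      using assms by (auto simp: u_def power2_norm_eq_inner[symmetric] field_simps)
    then show ?thesis by (simp add: \<rho>_def expinv_def)
  qed
  moreover have "\<rho> x = 0" if "x \<notin> ball a (2 * r)" for x
  proof -
    have "(norm (x - a))\<^sup>2 \<ge> (2 * r)\<^sup>2"
      using that assms by (intro power_mono) (auto simp: dist_norm norm_minus_commute)
    \<comment> \<open>The denominator \<open>3 * r\<^sup>2\<close> of \<open>u\<close> is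
      \<open>(2 * r)\<^sup>2 - r\<^sup>2\<close>, which makes \<open>u\<close> equal to
      \<open>1\<close> on the sphere of radius \<open>2 * r\<close>.\<close>
    then have "u x \<ge> 1"
      using assms by (auto simp: u_def power2_norm_eq_inner[symmetric] field_simps)
    then have "?e 1 \<le> ?e (u x)" by (rule expinv_mono)
    then show ?thesis by (auto simp: \<rho>_def expinv_def)
  qed
  ultimately show ?thesis using that by blast
qed

section \<open>Charts and tangent vectors\<close>

locale atlas =
  fixes A :: "('a, 'e::euclidean_space) chart set"
  assumes smooth_atlas: "smooth_atlas A"
begin

abbreviation Dtr :: "('a, 'e) chart \<Rightarrow> ('a, 'e) chart \<Rightarrow> 'a \<Rightarrow> 'e \<Rightarrow> 'e" where
  "Dtr c d p \<equiv> frechet_derivative (snd d \<circ> cinv c) (at (snd c p))"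

lemma inj_chart: "c \<in> A \<Longrightarrow> inj_on (snd c) (fst c)"
  using smooth_atlas by (auto simp: smooth_atlas_def)

lemma cinv_chart [simp]: "c \<in> A \<Longrightarrow> p \<in> fst c \<Longrightarrow> cinv c (snd c p) = p"
  by (simp add: cinv_def inj_chart)

lemma cinv_in: "c \<in> A \<Longrightarrow> x \<in> cimg c \<Longrightarrow> cinv c x \<in> fst c"
  by (simp add: cinv_def cimg_def inv_into_into)

lemma chart_cinv [simp]: "c \<in> A \<Longrightarrow> x \<in> cimg c \<Longrightarrow> snd c (cinv c x) = x"
  by (simp add: cinv_def cimg_def f_inv_into_f)

lemma chart_in_cimg [simp]: "p \<in> fst c \<Longrightarrow> snd c p \<in> cimg c"
  by (simp add: cimg_def)

lemma open_cimg: "c \<in> A \<Longrightarrow> open (cimg c)"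
  using smooth_atlas by (auto simp: smooth_atlas_def)

lemma open_overlap: "c \<in> A \<Longrightarrow> d \<in> A \<Longrightarrow> open (snd c ` (fst c \<inter> fst d))"
  using smooth_atlas by (auto simp: smooth_atlas_def)

lemma smooth_transition:
  "c \<in> A \<Longrightarrow> d \<in> A \<Longrightarrow> smooth_on (snd c ` (fst c \<inter> fst d)) (snd d \<circ> cinv c)"
  using smooth_atlas by (auto simp: smooth_atlas_def)

lemma charts_at_iff: "c \<in> charts_at A p \<longleftrightarrow> c \<in> A \<and> p \<in> fst c"
  by (auto simp: charts_at_def)

lemma pointsE:
  assumes "p \<in> points A"
  obtains c where "c \<in> charts_at A p"
  using assms by (auto simp: points_def charts_at_def)

lemma point_of_chart: "c \<in> charts_at A p \<Longrightarrow> p \<in> points A"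
  by (auto simp: points_def charts_at_def)

text \<open>\<open>mtopology\<close> is built by the abstract constructor \<open>topology\<close>,
  which has the intended open sets only once they are shown to form a topology. Closure under
  intersection uses injectivity of the charts.\<close>

lemma openin_mtopology:
  "openin (mtopology A) W \<longleftrightarrow> W \<subseteq> points A \<and> (\<forall>c\<in>A. open (snd c ` (W \<inter> fst c)))"
proof -
  have "istopology (\<lambda>W. W \<subseteq> points A \<and> (\<forall>c\<in>A. open (snd c ` (W \<inter> fst c))))"
    unfolding istopology_def
  proof (intro conjI allI impI ballI)
    fix S T c assume S: "S \<subseteq> points A \<and> (\<forall>c\<in>A. open (snd c ` (S \<inter> fst c)))"
      and T: "T \<subseteq> points A \<and> (\<forall>c\<in>A. open (snd c ` (T \<inter> fst c)))" and c: "c \<in> A"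
    have "snd c ` (S \<inter> T \<inter> fst c) = snd c ` (S \<inter> fst c) \<inter> snd c ` (T \<inter> fst c)"
      using inj_on_image_Int[OF inj_chart[OF c], of "S \<inter> fst c" "T \<inter> fst c"] by (auto simp: Int_ac)
    then show "open (snd c ` (S \<inter> T \<inter> fst c))" using S T c by auto
  next
    fix \<K> c assume K: "\<forall>K\<in>\<K>. K \<subseteq> points A \<and> (\<forall>c\<in>A. open (snd c ` (K \<inter> fst c)))" and c: "c \<in> A"
    have "snd c ` (\<Union>\<K> \<inter> fst c) = (\<Union>K\<in>\<K>. snd c ` (K \<inter> fst c))" by auto
    then show "open (snd c ` (\<Union>\<K> \<inter> fst c))" using K c by (simp add: open_UN)
  qed blast+
  then show ?thesis by (simp add: mtopology_def)
qed

lemma topspace_mtopology [simp]: "topspace (mtopology A) = points A"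
proof -
  have "points A \<inter> fst c = fst c" if "c \<in> A" for c
    using that by (auto simp: points_def)
  then have "openin (mtopology A) (points A)"
    unfolding openin_mtopology using open_cimg by (auto simp: cimg_def)
  then show ?thesis
    by (metis openin_mtopology openin_subset openin_topspace subset_antisym)
qed

lemma open_transition_preimage:
  assumes "c \<in> A" "d \<in> A" "open U"
  shows "open (snd d ` {p \<in> fst c \<inter> fst d. snd c p \<in> U})"
proof -
  let ?O = "snd d ` (fst d \<inter> fst c)"
  have "continuous_on ?O (snd c \<circ> cinv d)"
    using smooth_on_continuous_on smooth_transition assms by blast
  then have "open ((snd c \<circ> cinv d) -` U \<inter> ?O)"
    using continuous_on_open_vimage[OF open_overlap[OF assms(2,1)]] assms(3) by blast
  moreover have "(snd c \<circ> cinv d) -` U \<inter> ?O = snd d ` {p \<in> fst c \<inter> fst d. snd c p \<in> U}"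
    using assms by (auto simp: image_iff)
  ultimately show ?thesis by simp
qed

lemma openin_chart_preimage:
  assumes "c \<in> A" "open U"
  shows "openin (mtopology A) {p \<in> fst c. snd c p \<in> U}"
  unfolding openin_mtopology
proof (intro conjI ballI)
  show "{p \<in> fst c. snd c p \<in> U} \<subseteq> points A" using assms by (auto simp: points_def)
  fix d assume "d \<in> A"
  moreover have "{p \<in> fst c. snd c p \<in> U} \<inter> fst d = {p \<in> fst c \<inter> fst d. snd c p \<in> U}" by auto
  ultimately show "open (snd d ` ({p \<in> fst c. snd c p \<in> U} \<inter> fst d))"
    using open_transition_preimage[OF assms(1) _ assms(2)] by simp
qed

lemma openin_chart: "c \<in> A \<Longrightarrow> openin (mtopology A) (fst c)"
  using openin_chart_preimage[of c UNIV] by simp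

text \<open>Inverse charts are continuous, so the image is compact, and compact sets are closed in a
  Hausdorff space. It makes the complement of the support of a bump function open in the whole
  manifold, not just in one chart.\<close>

lemma closedin_chart_compact:
  assumes "Hausdorff_space (mtopology A)" "c \<in> A" "compact K" "K \<subseteq> cimg c"
  shows "closedin (mtopology A) (cinv c ` K)"
proof -
  have "continuous_map (top_of_set (cimg c)) (mtopology A) (cinv c)"
    unfolding continuous_map
  proof (intro conjI allI impI)
    show "cinv c ` topspace (top_of_set (cimg c)) \<subseteq> topspace (mtopology A)"
      using cinv_in[OF assms(2)] assms(2) by (auto simp: points_def)
  next
    fix U assume "openin (mtopology A) U"
    then have "open (snd c ` (U \<inter> fst c))" using assms by (simp add: openin_mtopology)
    moreover have "{x \<in> topspace (top_of_set (cimg c)). cinv c x \<in> U} = snd c ` (U \<inter> fst c)"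
      using assms(2) cinv_in[OF assms(2)] by (force simp: image_iff)
    ultimately show "openin (top_of_set (cimg c)) {x \<in> topspace (top_of_set (cimg c)). cinv c x \<in> U}"
      using open_cimg[OF assms(2)] by (auto simp: openin_open_eq cimg_def)
  qed
  moreover have "compactin (top_of_set (cimg c)) K"
    using assms by (simp add: compactin_subtopology)
  ultimately show ?thesis
    using assms(1) image_compactin compactin_imp_closedin by blast
qed

section \<open>Jacobians of the transition maps and tangent vectors\<close>

lemma has_derivative_transition:
  assumes "c \<in> charts_at A p" "d \<in> charts_at A p"
  shows "((snd d \<circ> cinv c) has_derivative Dtr c d p) (at (snd c p))"
  using smooth_on_differentiable[OF smooth_transition[of c d]] assms
  by (simp add: charts_at_iff frechet_derivative_works)

lemma linear_Dtr: "c \<in> charts_at A p \<Longrightarrow> d \<in> charts_at A p \<Longrightarrow> linear (Dtr c d p)"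
  using has_derivative_transition has_derivative_linear by blast

lemma Dtr_self [simp]:
  assumes "c \<in> charts_at A p"
  shows "Dtr c c p w = w"
proof -
  have c: "c \<in> A" "p \<in> fst c" using assms by (auto simp: charts_at_iff)
  have "Dtr c c p = frechet_derivative (\<lambda>x. x) (at (snd c p))"
    by (rule frechet_derivative_cong_open[OF open_cimg[OF c(1)]]) (use c in auto)
  then show ?thesis by simp
qed

lemma Dtr_Dtr:
  assumes "c \<in> charts_at A p" "d \<in> charts_at A p" "e \<in> charts_at A p"
  shows "Dtr d e p (Dtr c d p w) = Dtr c e p w"
proof -
  have c: "c \<in> A" "p \<in> fst c" and d: "d \<in> A" "p \<in> fst d" and e: "e \<in> A" "p \<in> fst e"
    using assms by (auto simp: charts_at_iff)
  let ?O = "snd c ` (fst c \<inter> fst d)"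
  have "(snd d \<circ> cinv c) (snd c p) = snd d p" using c by simp
  then have "((snd e \<circ> cinv d) \<circ> (snd d \<circ> cinv c) has_derivative Dtr d e p \<circ> Dtr c d p) (at (snd c p))"
    using has_derivative_transition assms by (intro diff_chain_at) auto
  then have "((snd e \<circ> cinv c) has_derivative Dtr d e p \<circ> Dtr c d p) (at (snd c p))"
    by (rule has_derivative_transform_within_open[OF _ open_overlap[OF c(1) d(1)]]) (use c d in auto)
  then have "Dtr d e p \<circ> Dtr c d p = Dtr c e p"
    by (rule frechet_derivative_at)
  then show ?thesis by (metis comp_apply)
qed

lemma tangent_Dtr:
  "v \<in> tangent_space A p \<Longrightarrow> c \<in> charts_at A p \<Longrightarrow> d \<in> charts_at A p \<Longrightarrow> v d = Dtr c d p (v c)"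
  unfolding tangent_space_def by blast

lemma tangent_outside: "v \<in> tangent_space A p \<Longrightarrow> c \<notin> charts_at A p \<Longrightarrow> v c = 0"
  unfolding tangent_space_def by blast

lemma tangentI:
  assumes "\<And>c. c \<notin> charts_at A p \<Longrightarrow> v c = 0"
    and "\<And>c d. c \<in> charts_at A p \<Longrightarrow> d \<in> charts_at A p \<Longrightarrow> v d = Dtr c d p (v c)"
  shows "v \<in> tangent_space A p"
  unfolding tangent_space_def using assms by blast

lemma coord_vec_eq: "d \<in> charts_at A p \<Longrightarrow> coord_vec A c p w d = Dtr c d p w"
  by (simp add: coord_vec_def)

lemma coord_vec_self [simp]: "c \<in> charts_at A p \<Longrightarrow> coord_vec A c p w c = w"
  by (simp add: coord_vec_eq)

lemma coord_vec_in [simp]: "c \<in> charts_at A p \<Longrightarrow> coord_vec A c p w \<in> tangent_space A p"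
  by (rule tangentI) (simp_all add: coord_vec_def Dtr_Dtr)

lemma coord_vec_component [simp]:
  assumes "v \<in> tangent_space A p" "c \<in> charts_at A p"
  shows "coord_vec A c p (v c) = v"
proof
  show "coord_vec A c p (v c) d = v d" for d
    using assms tangent_Dtr tangent_outside by (metis coord_vec_def)
qed

lemma tangent_eqI:
  "v \<in> tangent_space A p \<Longrightarrow> w \<in> tangent_space A p \<Longrightarrow> c \<in> charts_at A p \<Longrightarrow> v c = w c \<Longrightarrow> v = w"
  by (metis coord_vec_component)

lemma subspace_tangent_space: "subspace (tangent_space A p)"
proof (rule subspaceI)
  fix v w a assume v: "v \<in> tangent_space A p"
  show "a *\<^sub>R v \<in> tangent_space A p"
    by (rule tangentI) (simp_all add: tangent_outside[OF v] linear_scale[OF linear_Dtr] tangent_Dtr[OF v, symmetric])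
  assume w: "w \<in> tangent_space A p"
  show "v + w \<in> tangent_space A p"
    by (rule tangentI) (simp_all add: tangent_outside[OF v] tangent_outside[OF w] linear_add[OF linear_Dtr]
        tangent_Dtr[OF v, symmetric] tangent_Dtr[OF w, symmetric])
qed (rule tangentI, simp_all add: linear_0[OF linear_Dtr])

lemma linear_coord_vec:
  assumes "c \<in> charts_at A p"
  shows "linear (coord_vec A c p)"
  by (rule linearI; rule ext)
    (simp_all add: coord_vec_def linear_add[OF linear_Dtr[OF assms]] linear_scale[OF linear_Dtr[OF assms]])

lemma bump_at:
  assumes "c \<in> charts_at A p"
  obtains \<rho> :: "'e \<Rightarrow> real" and K W where "smooth_on UNIV \<rho>" "compact K" "K \<subseteq> cimg c"
    "\<And>x. x \<notin> K \<Longrightarrow> \<rho> x = 0" "openin (mtopology A) W" "p \<in> W" "W \<subseteq> fst c"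
    "\<And>q. q \<in> W \<Longrightarrow> \<rho> (snd c q) = 1"
proof -
  have c: "c \<in> A" "p \<in> fst c" using assms by (auto simp: charts_at_iff)
  obtain s where s: "s > 0" "cball (snd c p) s \<subseteq> cimg c"
    using open_cimg[OF c(1)] chart_in_cimg[OF c(2)] open_contains_cball by blast
  obtain \<rho> :: "'e \<Rightarrow> real" where \<rho>: "smooth_on UNIV \<rho>" "\<And>x. x \<in> ball (snd c p) (s/2) \<Longrightarrow> \<rho> x = 1"
    "\<And>x. x \<notin> ball (snd c p) (2 * (s/2)) \<Longrightarrow> \<rho> x = 0"
    \<comment> \<open>With half the radius, the bump vanishes off the ball of radius
      \<open>s\<close>, whose closure is compact and lies in the chart image.\<close>
    using bump_exists[of "s/2" "snd c p"] s by auto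
  show ?thesis
  proof (rule that[of \<rho> "cball (snd c p) s" "{q \<in> fst c. snd c q \<in> ball (snd c p) (s/2)}"])
    show "openin (mtopology A) {q \<in> fst c. snd c q \<in> ball (snd c p) (s/2)}"
      by (rule openin_chart_preimage[OF c(1) open_ball])
  qed (use \<rho> s c in auto)
qed

end

locale hausdorff_atlas = atlas A for A :: "('a, 'e::euclidean_space) chart set" +
  assumes Hausdorff: "Hausdorff_space (mtopology A)"
begin

text \<open>A point of the chart \<open>d\<close> has one of two kinds of neighbourhoods: if it lies
  in the domain of \<open>c\<close>, the overlap, on which the function is \<open>G\<close>;
  otherwise the complement of the compact set, which is open by the Hausdorff property and on which
  the function is zero.\<close>

lemma smooth_extension:
  fixes g :: "'a \<Rightarrow> 'f::real_normed_vector"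
  assumes "c \<in> A" "d \<in> A" "compact K" "K \<subseteq> cimg c"
    and "smooth_on (snd d ` (fst c \<inter> fst d)) G"
    and "\<And>q. q \<in> fst c \<Longrightarrow> q \<in> fst d \<Longrightarrow> g q = G (snd d q)"
    and "\<And>q. q \<in> fst d \<Longrightarrow> q \<notin> cinv c ` K \<Longrightarrow> g q = 0"
  shows "smooth_on (cimg d) (g \<circ> cinv d)"
proof (rule smooth_on_local)
  fix x assume x: "x \<in> cimg d"
  define q where "q = cinv d x"
  have q: "q \<in> fst d" "snd d q = x" using x assms(2) by (auto simp: q_def cinv_in)
  show "\<exists>T. open T \<and> x \<in> T \<and> smooth_on T (g \<circ> cinv d)"
  proof (cases "q \<in> fst c")
    case True
    have "smooth_on (snd d ` (fst c \<inter> fst d)) (g \<circ> cinv d)"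
      by (rule smooth_on_cong[OF _ _ assms(5)])
        (use assms open_overlap[of d c] in \<open>auto simp: Int_commute\<close>)
    then show ?thesis
      using q True open_overlap[OF assms(2,1)] by (intro exI[of _ "snd d ` (fst c \<inter> fst d)"]) (auto simp: Int_commute)
  next
    case False
    let ?W = "points A - cinv c ` K"
    have "openin (mtopology A) ?W"
      using closedin_chart_compact[OF Hausdorff assms(1,3,4)] by (auto simp: closedin_def)
    then have O: "open (snd d ` (?W \<inter> fst d))"
      using assms(2) by (simp add: openin_mtopology)
    have "smooth_on (snd d ` (?W \<inter> fst d)) (g \<circ> cinv d)"
      by (rule smooth_on_cong[OF O, of "\<lambda>x. 0"]) (use assms(2,7) in auto)
    moreover have "q \<in> ?W"
      using False q cinv_in[OF assms(1)] assms(2,4) by (auto simp: points_def)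
    ultimately show ?thesis using O q by blast
  qed
qed

lemma smooth_fun_extension:
  assumes "c \<in> A" "compact K" "K \<subseteq> cimg c" "smooth_on (cimg c) F" "\<And>x. x \<in> cimg c \<Longrightarrow> x \<notin> K \<Longrightarrow> F x = 0"
  shows "smooth_fun A (\<lambda>q. if q \<in> fst c then F (snd c q) else 0)"
  unfolding smooth_fun_def
proof
  fix d assume d: "d \<in> A"
  have O: "open (snd d ` (fst c \<inter> fst d))" using open_overlap[OF d assms(1)] by (simp add: Int_commute)
  have tr: "smooth_on (snd d ` (fst c \<inter> fst d)) (snd c \<circ> cinv d)"
    using smooth_transition[OF d assms(1)] by (simp add: Int_commute)
  have "smooth_on (snd d ` (fst c \<inter> fst d)) (\<lambda>x. F ((snd c \<circ> cinv d) x))"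
    by (rule smooth_on_compose[OF O open_cimg[OF assms(1)] _ tr assms(4)]) (use assms d in auto)
  then show "smooth_on (cimg d) ((\<lambda>q. if q \<in> fst c then F (snd c q) else 0) \<circ> cinv d)"
    by (rule smooth_extension[OF assms(1) d assms(2,3)])
      (use assms d in \<open>auto simp: image_iff; metis chart_in_cimg cinv_chart\<close>)+
qed

definition chart_field :: "('a, 'e) chart \<Rightarrow> ('e \<Rightarrow> 'e) \<Rightarrow> 'a \<Rightarrow> ('a, 'e) tvec" where
  "chart_field c F q = (if q \<in> fst c then coord_vec A c q (F (snd c q)) else 0)"

lemma vector_field_chart_field:
  assumes "c \<in> A" "compact K" "K \<subseteq> cimg c" "smooth_on (cimg c) F" "\<And>x. x \<in> cimg c \<Longrightarrow> x \<notin> K \<Longrightarrow> F x = 0"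
  shows "vector_field A (chart_field c F)"
  unfolding vector_field_def
proof (intro conjI ballI allI impI)
  show "chart_field c F p \<in> tangent_space A p" if "p \<in> points A" for p
    using assms(1) subspace_0[OF subspace_tangent_space] by (auto simp: chart_field_def charts_at_iff)
  show "chart_field c F p = 0" if "p \<notin> points A" for p
    using that assms(1) by (auto simp: chart_field_def points_def)
  fix d assume d: "d \<in> A"
  let ?O = "snd d ` (fst c \<inter> fst d)"
  have O: "open ?O" using open_overlap[OF d assms(1)] by (simp add: Int_commute)
  have O': "open (snd c ` (fst c \<inter> fst d))" using open_overlap[OF assms(1) d] .
  have tr: "smooth_on ?O (snd c \<circ> cinv d)" using smooth_transition[OF d assms(1)] by (simp add: Int_commute)
  have F: "smooth_on ?O (\<lambda>x. F ((snd c \<circ> cinv d) x))"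
    by (rule smooth_on_compose[OF O open_cimg[OF assms(1)] _ tr assms(4)]) (use assms d in auto)
  have D: "smooth_on ?O (\<lambda>x. frechet_derivative (snd d \<circ> cinv c) (at ((snd c \<circ> cinv d) x)) b)" for b
    by (rule smooth_on_compose[OF O O' _ tr smooth_on_deriv[OF smooth_transition[OF assms(1) d]]])
      (use assms d in auto)
  \<comment> \<open>These are the components of the field in the chart \<open>d\<close>: the
    Jacobian and the vector it is applied to both vary with the point.\<close>
  have G: "smooth_on ?O (\<lambda>x. frechet_derivative (snd d \<circ> cinv c) (at ((snd c \<circ> cinv d) x)) (F ((snd c \<circ> cinv d) x)))"
    by (rule smooth_on_linear_family[OF O _ D F])
      (use assms(1) d in \<open>auto intro!: linear_Dtr simp: charts_at_iff\<close>)
  have "smooth_on (cimg d) ((\<lambda>q. chart_field c F q d) \<circ> cinv d)"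
  proof (rule smooth_extension[OF assms(1) d assms(2,3) G])
    fix q assume q: "q \<in> fst c" "q \<in> fst d"
    then show "chart_field c F q d = frechet_derivative (snd d \<circ> cinv c) (at ((snd c \<circ> cinv d) (snd d q)))
        (F ((snd c \<circ> cinv d) (snd d q)))"
      using assms(1) d by (simp add: chart_field_def coord_vec_def charts_at_iff)
  next
    fix q assume q: "q \<in> fst d" "q \<notin> cinv c ` K"
    show "chart_field c F q d = 0"
    proof (cases "q \<in> fst c")
      case True
      then have "snd c q \<notin> K" using q assms(1) by (metis cinv_chart imageI)
      then show ?thesis
        using True assms(5)[of "snd c q"] linear_0[OF linear_coord_vec[of c q]] assms(1)
        by (simp add: chart_field_def charts_at_iff)
    qed (simp add: chart_field_def)
  qed
  then show "smooth_on (cimg d) (\<lambda>x. chart_field c F (cinv d x) d)" by (simp add: o_def)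
qed

text \<open>Constant components in one chart, cut off by a bump function, already form a global
  field. Since lifted tensors are specified only on lifts of global fields, this is what makes them
  determined at every point.\<close>

lemma vector_field_through:
  assumes "p \<in> points A" "v \<in> tangent_space A p"
  obtains X where "vector_field A X" "X p = v"
proof -
  obtain c where c: "c \<in> charts_at A p" using assms(1) pointsE by blast
  obtain \<rho> :: "'e \<Rightarrow> real" and K W where \<rho>: "smooth_on UNIV \<rho>" "compact K" "K \<subseteq> cimg c"
    "\<And>x. x \<notin> K \<Longrightarrow> \<rho> x = 0" "openin (mtopology A) W" "p \<in> W" "W \<subseteq> fst c"
    "\<And>q. q \<in> W \<Longrightarrow> \<rho> (snd c q) = 1"
    using bump_at[OF c] by blast
  have cA: "c \<in> A" using c by (simp add: charts_at_iff)
  show ?thesis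
  proof
    show "vector_field A (chart_field c (\<lambda>x. \<rho> x *\<^sub>R v c))"
      by (rule vector_field_chart_field[OF cA \<rho>(2,3)])
        (use \<rho> open_cimg[OF cA] in \<open>auto intro!: smooth_on_scaleR smooth_on_subset[OF \<rho>(1)]\<close>)
    show "chart_field c (\<lambda>x. \<rho> x *\<^sub>R v c) p = v"
      using \<rho> c assms by (auto simp: chart_field_def)
  qed
qed

end

section \<open>The tangent bundle as a manifold\<close>

text \<open>A countable basis of the model space, pulled back through countably many charts that
  cover the manifold, is a countable basis of the manifold.\<close>

lemma (in atlas) second_countable_mtopology:
  assumes "countable C" "C \<subseteq> A" "points C = points A"
  shows "second_countable (mtopology A)"
proof -
  obtain B :: "'e set set" where B: "countable B" "topological_basis B"
    using ex_countable_basis by blast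
  let ?pre = "\<lambda>(c, U). {p \<in> fst c. snd c p \<in> U}"
  show ?thesis
    unfolding second_countable_def
  proof (intro exI conjI ballI allI impI)
    show "countable (?pre ` (C \<times> B))" using assms(1) B by auto
    show "openin (mtopology A) V" if "V \<in> ?pre ` (C \<times> B)" for V
      using that assms(2) openin_chart_preimage topological_basis_open[OF B(2)] by auto
    fix U p assume "openin (mtopology A) U \<and> p \<in> U"
    then have U: "openin (mtopology A) U" "p \<in> U" by auto
    then have "p \<in> points C" using assms(3) openin_subset by fastforce
    then obtain c where c: "c \<in> C" "p \<in> fst c" by (auto simp: points_def)
    have cA: "c \<in> A" using c assms(2) by auto
    have "open (snd c ` (U \<inter> fst c))" "snd c p \<in> snd c ` (U \<inter> fst c)"
      using U c cA by (auto simp: openin_mtopology)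
    then obtain O' where O': "O' \<in> B" "snd c p \<in> O'" "O' \<subseteq> snd c ` (U \<inter> fst c)"
      using topological_basisE[OF B(2)] by metis
    have "?pre (c, O') \<subseteq> U"
    proof
      fix q assume "q \<in> ?pre (c, O')"
      then have q: "q \<in> fst c" "snd c q \<in> snd c ` (U \<inter> fst c)" using O'(3) by auto
      then show "q \<in> U" using inj_onD[OF inj_chart[OF cA]] by fastforce
    qed
    then show "\<exists>V\<in>?pre ` (C \<times> B). p \<in> V \<and> V \<subseteq> U"
      using c O' by (intro bexI[of _ "?pre (c, O')"]) auto
  qed
qed

text \<open>The atlas may be uncountable, but a second countable space is Lindelof, so countably
  many chart domains cover it. Several charts can share a domain, hence one chart is chosen for
  each. The induced charts of the subatlas then cover the tangent bundle.\<close>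

lemma (in atlas) countable_subatlas:
  assumes "second_countable (mtopology A)"
  obtains C where "countable C" "C \<subseteq> A" "points C = points A"
proof -
  have "\<Union>(fst ` A) = topspace (mtopology A)" by (simp add: points_def)
  moreover have "\<forall>U\<in>fst ` A. openin (mtopology A) U" using openin_chart by blast
  ultimately have "\<exists>\<V>. countable \<V> \<and> \<V> \<subseteq> fst ` A \<and> \<Union>\<V> = points A"
    using second_countable_imp_Lindelof_space[OF assms, unfolded Lindelof_space_def, THEN spec, of "fst ` A"]
    by simp
  then obtain \<V> where \<V>: "countable \<V>" "\<V> \<subseteq> fst ` A" "\<Union>\<V> = points A"
    by (elim exE conjE)
  define s where "s = (\<lambda>V. SOME c. c \<in> A \<and> fst c = V)"
  have s: "s V \<in> A \<and> fst (s V) = V" if "V \<in> \<V>" for V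
  proof -
    from that \<V>(2) have "V \<in> fst ` A" by (rule subsetD[rotated])
    then obtain c where "V = fst c" "c \<in> A" by (rule imageE)
    then show ?thesis using someI[of "\<lambda>c. c \<in> A \<and> fst c = V" c] by (simp only: s_def)
  qed
  have "fst ` s ` \<V> = \<V>" using s by (simp add: image_image cong: image_cong)
  then have "points (s ` \<V>) = points A" using \<V>(3) by (simp only: points_def)
  moreover have "s ` \<V> \<subseteq> A" using s by blast
  ultimately show ?thesis using that[of "s ` \<V>"] \<V>(1) by simp
qed

context atlas
begin

abbreviation TA :: "('a \<times> ('a, 'e) tvec, 'e \<times> 'e) chart set" where
  "TA \<equiv> tangent_bundle A"

lemma fst_tchart [simp]: "P \<in> fst (tchart A c) \<longleftrightarrow> fst P \<in> fst c \<and> snd P \<in> tangent_space A (fst P)"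
  by (auto simp: tchart_def)

lemma snd_tchart [simp]: "snd (tchart A c) P = (snd c (fst P), snd P c)"
  by (auto simp: tchart_def split_beta)

lemma tchart_in [simp]: "c \<in> A \<Longrightarrow> tchart A c \<in> TA"
  by (simp add: tangent_bundle_def)

text \<open>The zero vector is tangent at every point, so evaluation at \<open>(p, 0)\<close>
  recovers both the domain and the coordinate map of the base chart, even off the domain. It lets
  \<open>lift\<close>, a function of charts of the bundle, refer to the base chart by
  \<open>inv (tchart A)\<close>.\<close>

lemma inj_tchart: "inj (tchart A)"
proof (rule injI)
  fix c d assume eq: "tchart A c = tchart A d"
  have "p \<in> fst c \<longleftrightarrow> p \<in> fst d" for p
    using arg_cong[OF eq, of "\<lambda>t. (p, 0) \<in> fst t"] subspace_0[OF subspace_tangent_space] by simp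
  moreover have "snd c p = snd d p" for p
    using arg_cong[OF eq, of "\<lambda>t. fst (snd t (p, 0))"] by simp
  ultimately show "c = d" by (intro prod_eqI) auto
qed

lemma tchart_eq_iff [simp]: "tchart A c = tchart A d \<longleftrightarrow> c = d"
  using inj_tchart by (auto dest: injD)

lemma points_TA: "P \<in> points TA \<longleftrightarrow> fst P \<in> points A \<and> snd P \<in> tangent_space A (fst P)"
  by (auto simp: points_def tangent_bundle_def)

lemma charts_at_TA:
  "P \<in> points TA \<Longrightarrow> C \<in> charts_at TA P \<longleftrightarrow> (\<exists>c\<in>charts_at A (fst P). C = tchart A c)"
proof -
  assume "P \<in> points TA"
  then have "snd P \<in> tangent_space A (fst P)" by (simp add: points_TA)
  then show ?thesis by (auto simp: charts_at_def tangent_bundle_def)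
qed

lemma tchart_at: "P \<in> points TA \<Longrightarrow> c \<in> charts_at A (fst P) \<Longrightarrow> tchart A c \<in> charts_at TA P"
  by (auto simp: charts_at_TA)

lemma overlap_TA:
  assumes "c \<in> A" "d \<in> A"
  shows "snd (tchart A c) ` (fst (tchart A c) \<inter> fst (tchart A d)) =
    snd c ` (fst c \<inter> fst d) \<times> (UNIV :: 'e set)"
proof (intro equalityI subsetI)
  fix z assume "z \<in> snd c ` (fst c \<inter> fst d) \<times> (UNIV :: 'e set)"
  then obtain p where p: "p \<in> fst c" "p \<in> fst d" "fst z = snd c p" by auto
  have "z = snd (tchart A c) (p, coord_vec A c p (snd z))"
    using p assms by (simp add: prod_eq_iff charts_at_iff)
  then show "z \<in> snd (tchart A c) ` (fst (tchart A c) \<inter> fst (tchart A d))"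
    by (rule image_eqI) (use p assms in \<open>simp add: charts_at_iff\<close>)
qed auto

lemma cimg_tchart: "c \<in> A \<Longrightarrow> cimg (tchart A c) = cimg c \<times> UNIV"
  using overlap_TA[of c c] by (simp add: cimg_def)

lemma inj_on_tchart:
  assumes "c \<in> A"
  shows "inj_on (snd (tchart A c)) (fst (tchart A c))"
proof (rule inj_onI)
  fix P Q assume P: "P \<in> fst (tchart A c)" and Q: "Q \<in> fst (tchart A c)"
    and eq: "snd (tchart A c) P = snd (tchart A c) Q"
  have "fst P = fst Q" using P Q eq inj_onD[OF inj_chart[OF assms]] by auto
  moreover then have "snd P = snd Q"
    using P Q eq assms by (intro tangent_eqI[of _ "fst P" _ c]) (auto simp: charts_at_iff)
  ultimately show "P = Q" by (rule prod_eqI)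
qed

lemma cinv_tchart:
  assumes "c \<in> A" "x \<in> cimg c"
  shows "cinv (tchart A c) (x, y) = (cinv c x, coord_vec A c (cinv c x) y)"
  unfolding cinv_def[of "tchart A c"]
  by (rule inv_into_f_eq[OF inj_on_tchart[OF assms(1)]])
    (use assms in \<open>auto simp: charts_at_iff cinv_in\<close>)

lemma transition_TA:
  assumes "c \<in> A" "d \<in> A" "z \<in> snd c ` (fst c \<inter> fst d) \<times> UNIV"
  shows "(snd (tchart A d) \<circ> cinv (tchart A c)) z =
    ((snd d \<circ> cinv c) (fst z), frechet_derivative (snd d \<circ> cinv c) (at (fst z)) (snd z))"
proof -
  obtain p y where z: "z = (snd c p, y)" "p \<in> fst c" "p \<in> fst d" using assms(3) by auto
  then show ?thesis
    using assms(1,2) by (simp add: cinv_tchart coord_vec_eq charts_at_iff)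
qed

lemma smooth_atlas_TA: "smooth_atlas TA"
  unfolding smooth_atlas_def
proof (intro conjI ballI)
  fix C assume "C \<in> TA"
  then obtain c where c: "c \<in> A" "C = tchart A c" by (auto simp: tangent_bundle_def)
  show "inj_on (snd C) (fst C)" "open (cimg C)"
    using c inj_on_tchart open_cimg by (auto simp: cimg_tchart open_Times)
  fix D assume "D \<in> TA"
  then obtain d where d: "d \<in> A" "D = tchart A d" by (auto simp: tangent_bundle_def)
  let ?O = "snd c ` (fst c \<inter> fst d)"
  have O: "open ?O" "open (?O \<times> (UNIV :: 'e set))" using open_overlap[OF c(1) d(1)] by (auto simp: open_Times)
  then show "open (snd C ` (fst C \<inter> fst D))" using c d overlap_TA by simp
  have sm: "smooth_on (?O \<times> (UNIV :: 'e set)) fst" "smooth_on (?O \<times> (UNIV :: 'e set)) snd"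
    using smooth_on_fst[OF O(2) smooth_on_id[OF O(2)]] smooth_on_snd[OF O(2) smooth_on_id[OF O(2)]] by simp_all
  have 1: "smooth_on (?O \<times> (UNIV :: 'e set)) (\<lambda>z. (snd d \<circ> cinv c) (fst z))"
    by (rule smooth_on_compose[OF O(2,1) _ sm(1) smooth_transition[OF c(1) d(1)]]) auto
  have D: "smooth_on (?O \<times> (UNIV :: 'e set)) (\<lambda>z. frechet_derivative (snd d \<circ> cinv c) (at (fst z)) b)" for b
    by (rule smooth_on_compose[OF O(2,1) _ sm(1) smooth_on_deriv[OF smooth_transition[OF c(1) d(1)]]]) auto
  have 2: "smooth_on (?O \<times> (UNIV :: 'e set)) (\<lambda>z. frechet_derivative (snd d \<circ> cinv c) (at (fst z)) (snd z))"
    by (rule smooth_on_linear_family[OF O(2) _ D sm(2)])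
      (use c(1) d(1) in \<open>auto intro!: linear_Dtr simp: charts_at_iff\<close>)
  show "smooth_on (snd C ` (fst C \<inter> fst D)) (snd D \<circ> cinv C)"
    unfolding c d overlap_TA[OF c(1) d(1)]
    by (rule smooth_on_cong[OF O(2) _ smooth_on_Pair[OF O(2) 1 2]])
      (rule transition_TA[OF c(1) d(1), symmetric])
qed

interpretation TA: atlas TA
  by unfold_locales (rule smooth_atlas_TA)

text \<open>The second derivative of the transition map, in direction \<open>y\<close> first and
  then \<open>u\<close>. It is the inhomogeneous term in the transformation laws of both the
  Christoffel symbols and the tangent vectors of the bundle.\<close>

definition D2tr :: "('a, 'e) chart \<Rightarrow> ('a, 'e) chart \<Rightarrow> 'a \<Rightarrow> 'e \<Rightarrow> 'e \<Rightarrow> 'e" where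
  "D2tr c d p u y = frechet_derivative (\<lambda>x. frechet_derivative (snd d \<circ> cinv c) (at x) y) (at (snd c p)) u"

lemma has_derivative_D2tr:
  assumes "c \<in> charts_at A p" "d \<in> charts_at A p"
  shows "((\<lambda>x. frechet_derivative (snd d \<circ> cinv c) (at x) y) has_derivative (\<lambda>u. D2tr c d p u y)) (at (snd c p))"
  unfolding D2tr_def
  using smooth_on_differentiable[OF smooth_on_deriv[OF smooth_transition[of c d]], of "snd c p"] assms
  by (auto simp: frechet_derivative_works[symmetric] charts_at_iff)

text \<open>The Jacobian is known to be differentiable in the base point for each fixed direction
  only. Expanding the varying direction in the basis reduces joint differentiability to finitely
  many fixed directions and the product rule.\<close>

lemma has_derivative_Dtr:
  assumes c: "c \<in> charts_at A p" and d: "d \<in> charts_at A p"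
  shows "((\<lambda>z. frechet_derivative (snd d \<circ> cinv c) (at (fst z)) (snd z)) has_derivative
    (\<lambda>z. D2tr c d p (fst z) y + Dtr c d p (snd z))) (at (snd c p, y))"
proof -
  let ?\<phi> = "snd d \<circ> cinv c"
  let ?O = "snd c ` (fst c \<inter> fst d)"
  let ?x = "(snd c p, y)"
  have cA: "c \<in> A" "p \<in> fst c" and dA: "d \<in> A" "p \<in> fst d" using c d by (auto simp: charts_at_iff)
  have O: "open (?O \<times> (UNIV :: 'e set))" using open_overlap[OF cA(1) dA(1)] by (simp add: open_Times)
  have xO: "?x \<in> ?O \<times> UNIV" using cA dA by auto
  have fst': "(fst has_derivative fst) (at ?x)"
    by (rule bounded_linear_imp_has_derivative[OF bounded_linear_fst])
  have g: "((\<lambda>z. frechet_derivative ?\<phi> (at (fst z)) b) has_derivative (\<lambda>z. D2tr c d p (fst z) b)) (at ?x)" for b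
    by (rule has_derivative_compose[OF fst', where g = "\<lambda>x. frechet_derivative ?\<phi> (at x) b"])
      (simp only: fst_conv has_derivative_D2tr[OF c d])
  have lin: "linear (frechet_derivative ?\<phi> (at x))" if "x \<in> ?O" for x
    using that cA(1) dA(1) by (auto intro!: linear_Dtr simp: charts_at_iff)
  \<comment> \<open>Linearity in \<open>y\<close> is hidden in \<open>D2tr\<close>, since
    \<open>y\<close> occurs under the outer derivative. It follows from uniqueness of that
    derivative, because the Jacobian is linear in \<open>y\<close> on the whole overlap.\<close>
  have D2: "D2tr c d p v y = (\<Sum>b\<in>Basis. (y \<bullet> b) *\<^sub>R D2tr c d p v b)" for v y
  proof -
    have "((\<lambda>x. \<Sum>b\<in>Basis. (y \<bullet> b) *\<^sub>R frechet_derivative ?\<phi> (at x) b) has_derivative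
        (\<lambda>v. \<Sum>b\<in>Basis. (y \<bullet> b) *\<^sub>R D2tr c d p v b)) (at (snd c p))"
      by (intro has_derivative_sum has_derivative_scaleR_right has_derivative_D2tr[OF c d])
    then have "((\<lambda>x. frechet_derivative ?\<phi> (at x) y) has_derivative
        (\<lambda>v. \<Sum>b\<in>Basis. (y \<bullet> b) *\<^sub>R D2tr c d p v b)) (at (snd c p))"
      by (rule has_derivative_transform_within_open[OF _ open_overlap[OF cA(1) dA(1)]])
        (use cA dA linear_expand[OF lin] in auto)
    from fun_cong[OF has_derivative_unique[OF has_derivative_D2tr[OF c d] this]] show ?thesis .
  qed
  have "((\<lambda>z. \<Sum>b\<in>Basis. (snd z \<bullet> b) *\<^sub>R frechet_derivative ?\<phi> (at (fst z)) b) has_derivative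
      (\<lambda>z. \<Sum>b\<in>Basis. (y \<bullet> b) *\<^sub>R D2tr c d p (fst z) b + (snd z \<bullet> b) *\<^sub>R Dtr c d p b)) (at ?x)"
    by (auto intro!: derivative_eq_intros g)
  then show ?thesis
    unfolding sum.distrib D2[of _ y, symmetric] linear_expand[OF linear_Dtr[OF c d], symmetric]
    by (rule has_derivative_transform_within_open[OF _ O xO]) (use linear_expand[OF lin] in auto)
qed

text \<open>The bundle transition sends \<open>(x, y)\<close> to the image of \<open>x\<close> and
  the Jacobian at \<open>x\<close> applied to \<open>y\<close>; the product rule for the latter
  yields the \<open>D2tr\<close> term. This term keeps the fibre component from being a tangent
  vector of the base, and the correction by the connection cancels it.\<close>

lemma Dtr_TA:
  assumes P: "P \<in> points TA" and c: "c \<in> charts_at A (fst P)" and d: "d \<in> charts_at A (fst P)"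
  shows "frechet_derivative (snd (tchart A d) \<circ> cinv (tchart A c)) (at (snd (tchart A c) P)) (u, w) =
    (Dtr c d (fst P) u, D2tr c d (fst P) u (snd P c) + Dtr c d (fst P) w)"
proof -
  let ?\<phi> = "snd d \<circ> cinv c" and ?p = "fst P"
  let ?O = "snd c ` (fst c \<inter> fst d)"
  let ?x = "(snd c ?p, snd P c)"
  have cA: "c \<in> A" "?p \<in> fst c" and dA: "d \<in> A" "?p \<in> fst d" using c d by (auto simp: charts_at_iff)
  have O: "open (?O \<times> (UNIV :: 'e set))" using open_overlap[OF cA(1) dA(1)] by (simp add: open_Times)
  have xO: "?x \<in> ?O \<times> UNIV" using cA dA by auto
  have "((\<lambda>z. ?\<phi> (fst z)) has_derivative (\<lambda>z. Dtr c d ?p (fst z))) (at ?x)"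
    by (rule has_derivative_compose[OF bounded_linear_imp_has_derivative[OF bounded_linear_fst]])
      (simp only: fst_conv has_derivative_transition[OF c d])
  then have "((\<lambda>z. (?\<phi> (fst z), frechet_derivative ?\<phi> (at (fst z)) (snd z))) has_derivative
      (\<lambda>z. (Dtr c d ?p (fst z), D2tr c d ?p (fst z) (snd P c) + Dtr c d ?p (snd z)))) (at ?x)"
    by (intro has_derivative_Pair has_derivative_Dtr[OF c d])
  then have "((snd (tchart A d) \<circ> cinv (tchart A c)) has_derivative
      (\<lambda>z. (Dtr c d ?p (fst z), D2tr c d ?p (fst z) (snd P c) + Dtr c d ?p (snd z)))) (at ?x)"
    by (rule has_derivative_transform_within_open[OF _ O xO]) (rule transition_TA[OF cA(1) dA(1), symmetric])
  from frechet_derivative_at[OF this] show ?thesis by (simp add: fun_eq_iff)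
qed

text \<open>Points over different base points are separated by preimages of open sets of the base.
  Points in one fibre have different components in any chart around the base point, and are
  separated by disjoint open sets of fibre coordinates. Second countability comes from a countable
  subatlas.\<close>

lemma smooth_manifold_TA:
  assumes "smooth_manifold A"
  shows "smooth_manifold TA"
proof -
  have "Hausdorff_space (mtopology TA)"
    unfolding Hausdorff_space_def TA.topspace_mtopology
  proof (intro allI impI)
    fix P Q assume "P \<in> points TA \<and> Q \<in> points TA \<and> P \<noteq> Q"
    then have PQ: "P \<in> points TA" "Q \<in> points TA" "P \<noteq> Q" by auto
    show "\<exists>U V. openin (mtopology TA) U \<and> openin (mtopology TA) V \<and> P \<in> U \<and> Q \<in> V \<and> disjnt U V"
    proof (cases "fst P = fst Q")
      case False
      then obtain U V where UV: "openin (mtopology A) U" "openin (mtopology A) V" "fst P \<in> U" "fst Q \<in> V" "disjnt U V"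
        using assms PQ unfolding smooth_manifold_def Hausdorff_space_def points_TA topspace_mtopology by blast
      have pre: "openin (mtopology TA) {R \<in> points TA. fst R \<in> U}" if "openin (mtopology A) U" for U
        unfolding TA.openin_mtopology
      proof (intro conjI ballI)
        fix C assume "C \<in> TA"
        then obtain c where c: "c \<in> A" "C = tchart A c" by (auto simp: tangent_bundle_def)
        have "snd C ` ({R \<in> points TA. fst R \<in> U} \<inter> fst C) = snd c ` (U \<inter> fst c) \<times> (UNIV :: 'e set)"
        proof (intro equalityI subsetI)
          fix z assume "z \<in> snd c ` (U \<inter> fst c) \<times> (UNIV :: 'e set)"
          then obtain p where p: "p \<in> U" "p \<in> fst c" "fst z = snd c p" by auto
          have pc: "c \<in> charts_at A p" using p c by (simp add: charts_at_iff)
          have "z = snd C (p, coord_vec A c p (snd z))"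
            using p c pc by (simp add: prod_eq_iff)
          then show "z \<in> snd C ` ({R \<in> points TA. fst R \<in> U} \<inter> fst C)"
            by (rule image_eqI) (use p c pc point_of_chart in \<open>auto simp: points_TA\<close>)
        qed (use c in auto)
        then show "open (snd C ` ({R \<in> points TA. fst R \<in> U} \<inter> fst C))"
          using that c by (simp add: openin_mtopology open_Times)
      qed auto
      show ?thesis
        by (intro exI[of _ "{R \<in> points TA. fst R \<in> U}"] exI[of _ "{R \<in> points TA. fst R \<in> V}"] conjI pre)
          (use UV PQ in \<open>auto simp: disjnt_iff\<close>)
    next
      case True
      obtain c where c: "c \<in> charts_at A (fst P)" using PQ pointsE by (auto simp: points_TA)
      have "snd P c \<noteq> snd Q c"
      proof
        assume "snd P c = snd Q c"
        moreover have "snd P \<in> tangent_space A (fst P)" "snd Q \<in> tangent_space A (fst P)"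
          using PQ(1,2) True by (simp_all add: points_TA)
        ultimately have "snd P = snd Q" using c by (metis tangent_eqI)
        then show False using PQ(3) True prod_eqI by blast
      qed
      from hausdorff[OF this]
      obtain U V where UV: "open U" "open V" "snd P c \<in> U" "snd Q c \<in> V" "U \<inter> V = {}"
        by blast
      have T: "tchart A c \<in> TA" using c by (simp add: charts_at_iff)
      note pre = TA.openin_chart_preimage[OF T open_Times[OF open_UNIV]]
      let ?U = "\<lambda>U. {R \<in> fst (tchart A c). snd (tchart A c) R \<in> UNIV \<times> U}"
      have "P \<in> ?U U" "Q \<in> ?U V" "disjnt (?U U) (?U V)"
        using UV(3-5) PQ(1,2) True c by (auto simp: disjnt_iff points_TA charts_at_iff)
      with pre[OF UV(1)] pre[OF UV(2)] show ?thesis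
        by (intro exI[of _ "?U U"] exI[of _ "?U V"] conjI)
    qed
  qed
  moreover have "second_countable (mtopology TA)"
  proof -
    obtain C where C: "countable C" "C \<subseteq> A" "points C = points A"
      using assms countable_subatlas by (auto simp: smooth_manifold_def)
    show ?thesis
    proof (rule TA.second_countable_mtopology[of "tchart A ` C"])
      have "P \<in> points (tchart A ` C) \<longleftrightarrow> fst P \<in> points C \<and> snd P \<in> tangent_space A (fst P)" for P
        by (auto simp: points_def)
      then show "points (tchart A ` C) = points TA"
        unfolding set_eq_iff points_TA C(3) by blast
    qed (use C in \<open>auto simp: tangent_bundle_def\<close>)
  qed
  ultimately show ?thesis by (simp add: smooth_manifold_def smooth_atlas_TA)
qed

end

section \<open>Connections in coordinates\<close>

lemma sum_fun_apply: "(\<Sum>i\<in>I. f i) x = (\<Sum>i\<in>I. f i x)"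
  by (induction I rule: infinite_finite_induct) simp_all

context atlas
begin

lemma vector_fieldD:
  assumes "vector_field A X"
  shows "p \<in> points A \<Longrightarrow> X p \<in> tangent_space A p" "p \<notin> points A \<Longrightarrow> X p = 0"
    "c \<in> A \<Longrightarrow> smooth_on (cimg c) (\<lambda>x. X (cinv c x) c)"
  using assms by (simp_all add: vector_field_def)

lemma vector_field_zero: "vector_field A 0"
  by (simp add: vector_field_def subspace_0[OF subspace_tangent_space])

lemma vector_field_add:
  assumes "vector_field A X" "vector_field A Y"
  shows "vector_field A (X + Y)"
  unfolding vector_field_def
  using vector_fieldD[OF assms(1)] vector_fieldD[OF assms(2)]
  by (simp add: subspace_add[OF subspace_tangent_space] smooth_on_add open_cimg)

lemma vector_field_scale:
  assumes "smooth_fun A f" "vector_field A X"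
  shows "vector_field A (\<lambda>q. f q *\<^sub>R X q)"
proof -
  have "smooth_on (cimg c) (\<lambda>x. f (cinv c x))" if "c \<in> A" for c
    using assms(1) that by (auto simp: smooth_fun_def o_def)
  then show ?thesis
    unfolding vector_field_def using vector_fieldD[OF assms(2)]
    by (simp add: subspace_scale[OF subspace_tangent_space] smooth_on_scaleR open_cimg)
qed

lemma vector_field_sum: "(\<And>i. i \<in> I \<Longrightarrow> vector_field A (X i)) \<Longrightarrow> vector_field A (\<Sum>i\<in>I. X i)"
  by (induction I rule: infinite_finite_induct) (auto simp: vector_field_zero vector_field_add)

lemma smooth_fun_mult: "smooth_fun A f \<Longrightarrow> smooth_fun A g \<Longrightarrow> smooth_fun A (\<lambda>q. f q * g q)"
  by (simp add: smooth_fun_def o_def smooth_on_mult open_cimg)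

end

locale connection = hausdorff_atlas A for A :: "('a, 'e::euclidean_space) chart set" +
  fixes D :: "('a \<Rightarrow> ('a, 'e) tvec) \<Rightarrow> ('a \<Rightarrow> ('a, 'e) tvec) \<Rightarrow> ('a \<Rightarrow> ('a, 'e) tvec)"
  assumes connection: "affine_connection A D"
begin

lemma connection_field: "vector_field A X \<Longrightarrow> vector_field A Y \<Longrightarrow> vector_field A (D X Y)"
  and connection_add_left: "vector_field A X \<Longrightarrow> vector_field A X' \<Longrightarrow> vector_field A Y \<Longrightarrow>
    D (X + X') Y = D X Y + D X' Y"
  and connection_add_right: "vector_field A X \<Longrightarrow> vector_field A Y \<Longrightarrow> vector_field A Y' \<Longrightarrow>
    D X (Y + Y') = D X Y + D X Y'"
  and connection_scale_left: "smooth_fun A f \<Longrightarrow> vector_field A X \<Longrightarrow> vector_field A Y \<Longrightarrow>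
    D (\<lambda>p. f p *\<^sub>R X p) Y = (\<lambda>p. f p *\<^sub>R D X Y p)"
  and connection_leibniz: "smooth_fun A f \<Longrightarrow> vector_field A X \<Longrightarrow> vector_field A Y \<Longrightarrow> c \<in> charts_at A p \<Longrightarrow>
    D X (\<lambda>q. f q *\<^sub>R Y q) p =
      f p *\<^sub>R D X Y p + frechet_derivative (f \<circ> cinv c) (at (snd c p)) (X p c) *\<^sub>R Y p"
  using connection point_of_chart[of c p] unfolding affine_connection_def by simp_all

lemma connection_sum_left:
  assumes Y: "vector_field A Y"
  shows "(\<And>i. i \<in> I \<Longrightarrow> vector_field A (X i)) \<Longrightarrow> D (\<Sum>i\<in>I. X i) Y = (\<Sum>i\<in>I. D (X i) Y)"
proof -
  have 0: "D 0 Y = 0"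
    using connection_add_left[OF vector_field_zero vector_field_zero Y]
    by (simp only: add_0_left add_cancel_right_right)
  assume "\<And>i. i \<in> I \<Longrightarrow> vector_field A (X i)"
  then show ?thesis
  proof (induction I rule: infinite_finite_induct)
    case (insert i I)
    then have "D (X i + sum X I) Y = D (X i) Y + D (sum X I) Y"
      by (intro connection_add_left vector_field_sum Y) simp_all
    moreover have "D (sum X I) Y = (\<Sum>i\<in>I. D (X i) Y)"
      using insert by (intro insert.IH) simp
    ultimately show ?case by (simp only: sum.insert[OF insert.hyps])
  qed (simp_all add: 0)
qed

lemma connection_sum_right:
  assumes X: "vector_field A X"
  shows "(\<And>i. i \<in> I \<Longrightarrow> vector_field A (Y i)) \<Longrightarrow> D X (\<Sum>i\<in>I. Y i) = (\<Sum>i\<in>I. D X (Y i))"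
proof -
  have 0: "D X 0 = 0"
    using connection_add_right[OF X vector_field_zero vector_field_zero]
    by (simp only: add_0_left add_cancel_right_right)
  assume "\<And>i. i \<in> I \<Longrightarrow> vector_field A (Y i)"
  then show ?thesis
  proof (induction I rule: infinite_finite_induct)
    case (insert i I)
    then have "D X (Y i + sum Y I) = D X (Y i) + D X (sum Y I)"
      by (intro connection_add_right vector_field_sum X) simp_all
    moreover have "D X (sum Y I) = (\<Sum>i\<in>I. D X (Y i))"
      using insert by (intro insert.IH) simp
    ultimately show ?case by (simp only: sum.insert[OF insert.hyps])
  qed (simp_all add: 0)
qed

text \<open>The last clause is the coordinate formula of the connection. It refers to derivatives of
  the frame fields instead of Christoffel symbols because the well-definedness of the symbols is
  deduced from it.\<close>

definition local_frame :: "('a, 'e) chart \<Rightarrow> 'a set \<Rightarrow> ('e \<Rightarrow> 'a \<Rightarrow> ('a, 'e) tvec) \<Rightarrow> bool" where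
  "local_frame c W E \<longleftrightarrow> openin (mtopology A) W \<and> W \<subseteq> fst c \<and> (\<forall>i. vector_field A (E i)) \<and>
     (\<forall>i. \<forall>q\<in>W. E i q = coord_vec A c q i) \<and>
     (\<forall>X Y. \<forall>q\<in>W. vector_field A X \<and> vector_field A Y \<longrightarrow> D X Y q c =
        frechet_derivative (\<lambda>x. Y (cinv c x) c) (at (snd c q)) (X q c) +
        (\<Sum>i\<in>Basis. \<Sum>j\<in>Basis. ((X q c \<bullet> i) * (Y q c \<bullet> j)) *\<^sub>R D (E i) (E j) q c))"

lemma local_frameD:
  assumes "local_frame c W E"
  shows "openin (mtopology A) W" "W \<subseteq> fst c" "vector_field A (E i)" "q \<in> W \<Longrightarrow> E i q = coord_vec A c q i"
    "vector_field A X \<Longrightarrow> vector_field A Y \<Longrightarrow> q \<in> W \<Longrightarrow> D X Y q c =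
        frechet_derivative (\<lambda>x. Y (cinv c x) c) (at (snd c q)) (X q c) +
        (\<Sum>i\<in>Basis. \<Sum>j\<in>Basis. ((X q c \<bullet> i) * (Y q c \<bullet> j)) *\<^sub>R D (E i) (E j) q c)"
  using assms by (simp_all add: local_frame_def)

text \<open>With a bump function \<open>f\<close> around \<open>p\<close> and \<open>E\<^sub>i\<close> the extension of \<open>f \<partial>\<^sub>i\<close> by zero, every field
  satisfies the global identity \<open>f\<^sup>2 Y = \<Sum>\<^sub>i (f Y\<^sup>i) E\<^sub>i\<close>, so that locality of the connection need not
  be established separately.\<close>

lemma local_frame_exists:
  assumes c: "c \<in> charts_at A p"
  obtains W E where "local_frame c W E" "p \<in> W"
proof -
  obtain \<rho> :: "'e \<Rightarrow> real" and K W where \<rho>: "smooth_on UNIV \<rho>" "compact K" "K \<subseteq> cimg c"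
    "\<And>x. x \<notin> K \<Longrightarrow> \<rho> x = 0" "openin (mtopology A) W" "p \<in> W" "W \<subseteq> fst c"
    "\<And>q. q \<in> W \<Longrightarrow> \<rho> (snd c q) = 1"
    using bump_at[OF c] by blast
  have cA: "c \<in> A" using c by (simp add: charts_at_iff)
  have Oc: "open (cimg c)" by (rule open_cimg[OF cA])
  have \<rho>c: "smooth_on (cimg c) \<rho>" using \<rho>(1) by (rule smooth_on_subset) simp
  define E where "E = (\<lambda>i. chart_field c (\<lambda>x. \<rho> x *\<^sub>R i))"
  define f where "f = (\<lambda>q. if q \<in> fst c then \<rho> (snd c q) else 0)"
  \<comment> \<open>The detour \<open>cinv c (snd c q)\<close> for \<open>q\<close> makes the value
    a function of the coordinates, the shape that \<open>smooth_fun_extension\<close>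
    expects.\<close>
  define comp where "comp = (\<lambda>(Z :: 'a \<Rightarrow> ('a, 'e) tvec) i q. if q \<in> fst c then \<rho> (snd c q) * (Z (cinv c (snd c q)) c \<bullet> i) else 0)"
  have E: "vector_field A (E i)" for i
    unfolding E_def using \<rho> by (intro vector_field_chart_field[OF cA \<rho>(2,3)] smooth_on_scaleR Oc \<rho>c) auto
  have Ecoord: "E i q = coord_vec A c q i" if "q \<in> W" for i q
    using that \<rho>(7,8) by (auto simp: E_def chart_field_def)
  have "smooth_fun A f"
    unfolding f_def using \<rho> by (intro smooth_fun_extension[OF cA \<rho>(2,3)] \<rho>c) auto
  then have ff: "smooth_fun A (\<lambda>q. f q * f q)" by (intro smooth_fun_mult)
  have comp: "smooth_fun A (comp Z i)" if "vector_field A Z" for Z i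
    unfolding comp_def using \<rho> vector_fieldD(3)[OF that cA]
    by (intro smooth_fun_extension[OF cA \<rho>(2,3), where F = "\<lambda>x. \<rho> x * (Z (cinv c x) c \<bullet> i)"]
        smooth_on_mult smooth_on_inner Oc \<rho>c) auto
  have decomp: "(\<lambda>q. (f q * f q) *\<^sub>R Z q) = (\<Sum>i\<in>Basis. (\<lambda>q. comp Z i q *\<^sub>R E i q))"
    if Z: "vector_field A Z" for Z
  proof
    fix q
    show "(f q * f q) *\<^sub>R Z q = (\<Sum>i\<in>Basis. (\<lambda>q. comp Z i q *\<^sub>R E i q)) q"
    proof (cases "q \<in> fst c")
      case True
      have q: "c \<in> charts_at A q" using True cA by (simp add: charts_at_iff)
      have Zq: "Z q \<in> tangent_space A q" using vector_fieldD(1)[OF Z point_of_chart[OF q]] .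
      have "(\<Sum>i\<in>Basis. comp Z i q *\<^sub>R E i q) =
          (\<Sum>i\<in>Basis. (f q * f q) *\<^sub>R (Z q c \<bullet> i) *\<^sub>R coord_vec A c q i)"
        using True cA by (intro sum.cong)
          (simp_all add: comp_def E_def f_def chart_field_def linear_scale[OF linear_coord_vec[OF q]])
      also have "\<dots> = (f q * f q) *\<^sub>R coord_vec A c q (Z q c)"
        by (subst linear_expand[OF linear_coord_vec[OF q]]) (simp add: scaleR_sum_right)
      also have "\<dots> = (f q * f q) *\<^sub>R Z q" using Zq q by simp
      finally show ?thesis by (simp add: fun_eq_iff sum_fun_apply)
    qed (simp add: f_def comp_def sum_fun_apply)
  qed
  have local: "D X Y q c = frechet_derivative (\<lambda>x. Y (cinv c x) c) (at (snd c q)) (X q c) +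
      (\<Sum>i\<in>Basis. \<Sum>j\<in>Basis. ((X q c \<bullet> i) * (Y q c \<bullet> j)) *\<^sub>R D (E i) (E j) q c)"
    if X: "vector_field A X" and Y: "vector_field A Y" and qW: "q \<in> W" for X Y q
  proof -
    have qc: "q \<in> fst c" "c \<in> charts_at A q" using qW \<rho>(7) cA by (auto simp: charts_at_iff)
    let ?O = "snd c ` (W \<inter> fst c)"
    have O: "open ?O" "snd c q \<in> ?O" using \<rho>(5) qW qc cA by (auto simp: openin_mtopology)
    have onO: "\<rho> x = 1" "cinv c x \<in> fst c" "snd c (cinv c x) = x" if "x \<in> ?O" for x
      using that \<rho>(8) cA by auto
    have fq: "f q = 1" using qW qc \<rho>(8) by (simp add: f_def)
    have compq: "comp Z i q = Z q c \<bullet> i" for Z i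
      using qW qc cA \<rho>(8) by (simp add: comp_def)
    have left: "D X (E j) q c = (\<Sum>i\<in>Basis. (X q c \<bullet> i) *\<^sub>R D (E i) (E j) q c)" for j
    proof -
      have "D X (E j) q = D (\<lambda>q. (f q * f q) *\<^sub>R X q) (E j) q"
        using connection_scale_left[OF ff X E, of j] fq by simp
      also have "\<dots> = (\<Sum>i\<in>Basis. D (\<lambda>q. comp X i q *\<^sub>R E i q) (E j)) q"
        unfolding decomp[OF X] by (simp add: connection_sum_left E vector_field_scale comp X)
      also have "\<dots> = (\<Sum>i\<in>Basis. (X q c \<bullet> i) *\<^sub>R D (E i) (E j) q)"
        by (simp add: connection_scale_left[OF comp[OF X] E E] sum_fun_apply compq)
      finally show ?thesis by (simp add: sum_fun_apply)
    qed
    let ?Y = "\<lambda>x. Y (cinv c x) c"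
    let ?DY = "frechet_derivative ?Y (at (snd c q)) (X q c)"
    \<comment> \<open>Near \<open>q\<close> the bump is \<open>1\<close>, so \<open>comp Y j\<close>
      is the plain \<open>j\<close>-th component of \<open>Y\<close> there and the Leibniz rule
      produces the derivative of the components of \<open>Y\<close>.\<close>
    have dcomp: "frechet_derivative (comp Y j \<circ> cinv c) (at (snd c q)) (X q c) = ?DY \<bullet> j" for j
    proof -
      have "frechet_derivative (comp Y j \<circ> cinv c) (at (snd c q)) = frechet_derivative (\<lambda>x. ?Y x \<bullet> j) (at (snd c q))"
        by (rule frechet_derivative_cong_open[OF O]) (use onO in \<open>auto simp: comp_def\<close>)
      also have "\<dots> = (\<lambda>v. frechet_derivative ?Y (at (snd c q)) v \<bullet> j)"
      proof (rule frechet_derivative_at[symmetric])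
        have "?Y differentiable (at (snd c q))"
          by (rule smooth_on_differentiable[OF vector_fieldD(3)[OF Y cA]]) (use qc in simp)
        then show "((\<lambda>x. ?Y x \<bullet> j) has_derivative (\<lambda>v. frechet_derivative ?Y (at (snd c q)) v \<bullet> j)) (at (snd c q))"
          by (intro has_derivative_inner_left) (simp add: frechet_derivative_works)
      qed
      finally show ?thesis by simp
    qed
    \<comment> \<open>The factor is constantly \<open>1\<close> near \<open>q\<close>, so its
      Leibniz term vanishes and multiplying \<open>Y\<close> by it does not change the derivative at
      \<open>q\<close>.\<close>
    have "frechet_derivative ((\<lambda>q. f q * f q) \<circ> cinv c) (at (snd c q)) = frechet_derivative (\<lambda>x. 1) (at (snd c q))"
      by (rule frechet_derivative_cong_open[OF O]) (use onO in \<open>auto simp: f_def\<close>)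
    then have "D X Y q = D X (\<lambda>q. (f q * f q) *\<^sub>R Y q) q"
      using connection_leibniz[OF ff X Y qc(2)] fq by simp
    also have "\<dots> = (\<Sum>j\<in>Basis. D X (\<lambda>q. comp Y j q *\<^sub>R E j q)) q"
      unfolding decomp[OF Y] by (simp add: connection_sum_right E vector_field_scale comp X Y)
    also have "\<dots> = (\<Sum>j\<in>Basis. (Y q c \<bullet> j) *\<^sub>R D X (E j) q + (?DY \<bullet> j) *\<^sub>R E j q)"
      by (simp add: sum_fun_apply connection_leibniz[OF comp[OF Y] X E qc(2)] compq dcomp)
    finally have "D X Y q c = (\<Sum>j\<in>Basis. (Y q c \<bullet> j) *\<^sub>R D X (E j) q c) + (\<Sum>j\<in>Basis. (?DY \<bullet> j) *\<^sub>R E j q c)"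
      by (simp add: sum_fun_apply sum.distrib)
    also have "(\<Sum>j\<in>Basis. (?DY \<bullet> j) *\<^sub>R E j q c) = ?DY"
      using qW qc by (simp add: Ecoord euclidean_representation)
    also have "(\<Sum>j\<in>Basis. (Y q c \<bullet> j) *\<^sub>R D X (E j) q c) =
        (\<Sum>j\<in>Basis. \<Sum>i\<in>Basis. ((X q c \<bullet> i) * (Y q c \<bullet> j)) *\<^sub>R D (E i) (E j) q c)"
      by (simp add: left scaleR_sum_right mult.commute)
    also have "\<dots> = (\<Sum>i\<in>Basis. \<Sum>j\<in>Basis. ((X q c \<bullet> i) * (Y q c \<bullet> j)) *\<^sub>R D (E i) (E j) q c)"
      by (rule sum.swap)
    finally show ?thesis by (simp add: add.commute)
  qed
  have "local_frame c W E"
    unfolding local_frame_def using \<rho>(5,7) E Ecoord local by simp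
  then show ?thesis using \<rho>(6) by (rule that)
qed

text \<open>For admissible fields the components are constant near \<open>p\<close>, so the
  derivative term of the coordinate formula vanishes and what remains is computed from one fixed
  frame. This value is the same for all admissible pairs, so the definite description is well posed.
  The indices may be arbitrary vectors, whence their basis expansion in \<open>z\<close>.\<close>

lemma christoffel_eq:
  assumes c: "c \<in> charts_at A p" and W: "openin (mtopology A) W" "p \<in> W" "W \<subseteq> fst c"
    and X: "vector_field A X" and Y: "vector_field A Y"
    and eq: "\<And>q. q \<in> W \<Longrightarrow> X q = coord_vec A c q i \<and> Y q = coord_vec A c q j"
  shows "christoffel A D c k i j p = D X Y p c \<bullet> k"
proof -
  have cA: "c \<in> A" using c by (simp add: charts_at_iff)
  obtain W' E where fr: "local_frame c W' E" and pW': "p \<in> W'"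
    by (rule local_frame_exists[OF c])
  define z where "z = (\<Sum>a\<in>Basis. \<Sum>b\<in>Basis. ((i \<bullet> a) * (j \<bullet> b)) *\<^sub>R D (E a) (E b) p c)"
  have val: "D X Y p c = z"
    if "vector_field A X" "vector_field A Y" "openin (mtopology A) W" "p \<in> W" "W \<subseteq> fst c"
      "\<And>q. q \<in> W \<Longrightarrow> X q = coord_vec A c q i \<and> Y q = coord_vec A c q j" for X Y W
  proof -
    have "frechet_derivative (\<lambda>x. Y (cinv c x) c) (at (snd c p)) = frechet_derivative (\<lambda>x. j) (at (snd c p))"
    proof (rule frechet_derivative_cong_open)
      show "open (snd c ` (W \<inter> fst c))" using that(3) cA by (simp add: openin_mtopology)
      show "snd c p \<in> snd c ` (W \<inter> fst c)" using that by auto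
      show "Y (cinv c x) c = j" if "x \<in> snd c ` (W \<inter> fst c)" for x
        using that \<open>\<And>q. q \<in> W \<Longrightarrow> X q = coord_vec A c q i \<and> Y q = coord_vec A c q j\<close> cA
        by (auto simp: charts_at_iff)
    qed
    then show ?thesis
      using local_frameD(5)[OF fr that(1,2) pW'] that(4,6) c by (simp add: z_def)
  qed
  show ?thesis
    unfolding christoffel_def
  proof (rule the_equality)
    show "\<forall>X' Y'. vector_field A X' \<and> vector_field A Y' \<and> (\<exists>W. openin (mtopology A) W \<and> p \<in> W \<and> W \<subseteq> fst c \<and>
        (\<forall>q\<in>W. X' q = coord_vec A c q i \<and> Y' q = coord_vec A c q j)) \<longrightarrow> D X Y p c \<bullet> k = D X' Y' p c \<bullet> k"
    proof (intro allI impI; elim conjE exE)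
      fix X' Y' V assume "vector_field A X'" "vector_field A Y'" "openin (mtopology A) V" "p \<in> V" "V \<subseteq> fst c"
        "\<forall>q\<in>V. X' q = coord_vec A c q i \<and> Y' q = coord_vec A c q j"
      then have "D X' Y' p c = z" by (intro val[of X' Y' V]) auto
      then show "D X Y p c \<bullet> k = D X' Y' p c \<bullet> k" using val[OF X Y W eq] by simp
    qed
    fix z' assume "\<forall>X Y. vector_field A X \<and> vector_field A Y \<and> (\<exists>W. openin (mtopology A) W \<and> p \<in> W \<and> W \<subseteq> fst c \<and>
        (\<forall>q\<in>W. X q = coord_vec A c q i \<and> Y q = coord_vec A c q j)) \<longrightarrow> z' = D X Y p c \<bullet> k"
    then show "z' = D X Y p c \<bullet> k" using X Y W eq by blast
  qed
qed

text \<open>The symbols are defined point by point, but one local frame serves all points of its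
  neighbourhood. There they are components of the smooth field \<open>D (E i) (E j)\<close>.\<close>

lemma smooth_christoffel:
  assumes "c \<in> A"
  shows "smooth_on (cimg c) (\<lambda>x. christoffel A D c k i j (cinv c x))"
proof (rule smooth_on_local)
  fix x assume x: "x \<in> cimg c"
  then have c: "c \<in> charts_at A (cinv c x)" using assms cinv_in by (simp add: charts_at_iff)
  obtain W E where fr: "local_frame c W E" and pW: "cinv c x \<in> W"
    by (rule local_frame_exists[OF c])
  note W = local_frameD(1)[OF fr] pW local_frameD(2)[OF fr] and E = local_frameD(3,4)[OF fr]
  let ?O = "snd c ` (W \<inter> fst c)"
  have O: "open ?O" using W assms by (simp add: openin_mtopology)
  have "?O \<subseteq> cimg c" by (auto simp: cimg_def)
  then have "smooth_on ?O (\<lambda>x. D (E i) (E j) (cinv c x) c \<bullet> k)"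
    using vector_fieldD(3)[OF connection_field[OF E(1) E(1)] assms]
    by (intro smooth_on_inner O smooth_on_const) (rule smooth_on_subset)
  then have "smooth_on ?O (\<lambda>x. christoffel A D c k i j (cinv c x))"
  proof (rule smooth_on_cong[OF O, rotated])
    fix y assume "y \<in> ?O"
    then have "cinv c y \<in> W" using assms by auto
    then show "D (E i) (E j) (cinv c y) c \<bullet> k = christoffel A D c k i j (cinv c y)"
      by (intro christoffel_eq[symmetric, OF _ W(1) _ W(3)]) (use E W(3) assms in \<open>auto simp: charts_at_iff\<close>)
  qed
  moreover have "x \<in> ?O" using W x assms cinv_in by (intro image_eqI[of _ _ "cinv c x"]) auto
  ultimately show "\<exists>T. open T \<and> x \<in> T \<and> smooth_on T (\<lambda>x. christoffel A D c k i j (cinv c x))"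
    using O by blast
qed

text \<open>The Christoffel symbols packaged as the bilinear map \<Gamma>(u, w). The order of the
  indices is that of \<open>hlift\<close>, whose fibre component is minus this map at the given
  field and the fibre point.\<close>

definition gam :: "('a, 'e) chart \<Rightarrow> 'a \<Rightarrow> 'e \<Rightarrow> 'e \<Rightarrow> 'e" where
  "gam c p u w = (\<Sum>l\<in>Basis. \<Sum>i\<in>Basis. \<Sum>k\<in>Basis.
     ((u \<bullet> i) * (w \<bullet> k) * christoffel A D c l i k p) *\<^sub>R l)"

lemma linear_gam_left: "linear (\<lambda>u. gam c p u w)"
  by (rule linearI) (simp_all add: gam_def inner_add_left sum.distrib[symmetric] scaleR_sum_right algebra_simps)

lemma linear_gam_right: "linear (gam c p u)"
  by (rule linearI) (simp_all add: gam_def inner_add_left sum.distrib[symmetric] scaleR_sum_right algebra_simps)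

lemma smooth_gam:
  fixes S :: "'s::euclidean_space set"
  assumes "c \<in> A" "open S" "smooth_on S x" "x ` S \<subseteq> cimg c" "smooth_on S u" "smooth_on S w"
  shows "smooth_on S (\<lambda>z. gam c (cinv c (x z)) (u z) (w z))"
proof -
  have "smooth_on S (\<lambda>z. christoffel A D c l i k (cinv c (x z)))" for l i k
    by (rule smooth_on_compose[OF assms(2) open_cimg[OF assms(1)] assms(4,3) smooth_christoffel[OF assms(1)]])
  then show ?thesis
    unfolding gam_def using assms
    by (intro smooth_on_sum smooth_on_scaleR smooth_on_mult smooth_on_inner) auto
qed

lemma connection_local:
  assumes c: "c \<in> charts_at A p" and X: "vector_field A X" and Y: "vector_field A Y"
  shows "D X Y p c = frechet_derivative (\<lambda>x. Y (cinv c x) c) (at (snd c p)) (X p c) + gam c p (X p c) (Y p c)"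
proof -
  obtain W E where fr: "local_frame c W E" and pW: "p \<in> W"
    by (rule local_frame_exists[OF c])
  note W = local_frameD(1)[OF fr] pW local_frameD(2)[OF fr] and E = local_frameD(3,4)[OF fr]
  have "christoffel A D c l i j p = D (E i) (E j) p c \<bullet> l" for l i j
    by (rule christoffel_eq[OF c W E(1) E(1)]) (simp add: E(2))
  then have "gam c p u w = (\<Sum>l\<in>Basis. ((\<Sum>i\<in>Basis. \<Sum>j\<in>Basis. ((u \<bullet> i) * (w \<bullet> j)) *\<^sub>R D (E i) (E j) p c) \<bullet> l) *\<^sub>R l)" for u w
    by (simp add: gam_def inner_sum_left scaleR_sum_left)
  then show ?thesis
    unfolding local_frameD(5)[OF fr X Y pW] by (simp add: euclidean_representation)
qed

text \<open>Extend \<open>u\<close> and \<open>w\<close> to global fields \<open>X\<close> and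
  \<open>Y\<close>. The components of \<open>D X Y\<close> at \<open>p\<close> in the two charts are
  related by the Jacobian. Substituting the coordinate formula on both sides and eliminating the
  derivatives of the components of \<open>Y\<close> leaves this identity.\<close>

lemma gam_transform:
  assumes c: "c \<in> charts_at A p" and d: "d \<in> charts_at A p"
  shows "gam d p (Dtr c d p u) (Dtr c d p w) = Dtr c d p (gam c p u w) - D2tr c d p u w"
proof -
  have cA: "c \<in> A" "p \<in> fst c" and dA: "d \<in> A" "p \<in> fst d" using c d by (auto simp: charts_at_iff)
  have pA: "p \<in> points A" by (rule point_of_chart[OF c])
  obtain X where X: "vector_field A X" "X p = coord_vec A c p u"
    by (rule vector_field_through[OF pA coord_vec_in[OF c]])
  obtain Y where Y: "vector_field A Y" "Y p = coord_vec A c p w"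
    by (rule vector_field_through[OF pA coord_vec_in[OF c]])
  let ?\<phi> = "snd d \<circ> cinv c"
  let ?O = "snd c ` (fst c \<inter> fst d)"
  have O: "open ?O" "snd c p \<in> ?O" using open_overlap[OF cA(1) dA(1)] cA dA by auto
  let ?Yc = "\<lambda>x. Y (cinv c x) c" and ?Yd = "\<lambda>x. Y (cinv d x) d"
  let ?DYc = "frechet_derivative ?Yc (at (snd c p))" and ?DYd = "frechet_derivative ?Yd (at (snd d p))"
  have Yc: "(?Yc has_derivative ?DYc) (at (snd c p))"
    using smooth_on_differentiable[OF vector_fieldD(3)[OF Y(1) cA(1)], of "snd c p"] cA
    by (simp add: frechet_derivative_works)
  have Yd: "(?Yd has_derivative ?DYd) (at (snd d p))"
    using smooth_on_differentiable[OF vector_fieldD(3)[OF Y(1) dA(1)], of "snd d p"] dA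
    by (simp add: frechet_derivative_works)
  \<comment> \<open>Near \<open>p\<close> the components of \<open>Y\<close> in \<open>d\<close> are
    the Jacobian applied to those in \<open>c\<close>. The two expressions are differentiated
    separately, by the product rule here and by the chain rule next, and the results are
    equated.\<close>
  have "((\<lambda>x. frechet_derivative ?\<phi> (at x) (?Yc x)) has_derivative
      (\<lambda>v. D2tr c d p v w + Dtr c d p (?DYc v))) (at (snd c p))"
    by (rule has_derivative_compose[OF has_derivative_Pair[OF has_derivative_ident Yc],
        where g = "\<lambda>z. frechet_derivative ?\<phi> (at (fst z)) (snd z)"
          and g' = "\<lambda>z. D2tr c d p (fst z) w + Dtr c d p (snd z)", unfolded fst_conv snd_conv])
      (use has_derivative_Dtr[OF c d, of w] Y(2) c cA in simp)
  moreover have "((\<lambda>x. ?Yd (?\<phi> x)) has_derivative (\<lambda>v. ?DYd (Dtr c d p v))) (at (snd c p))"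
    by (rule has_derivative_compose[OF has_derivative_transition[OF c d]]) (use Yd cA in simp)
  then have "((\<lambda>x. frechet_derivative ?\<phi> (at x) (?Yc x)) has_derivative (\<lambda>v. ?DYd (Dtr c d p v))) (at (snd c p))"
  proof (rule has_derivative_transform_within_open[OF _ O])
    fix x assume "x \<in> ?O"
    then obtain q where q: "q \<in> fst c" "q \<in> fst d" "x = snd c q" by auto
    have "c \<in> charts_at A q" "d \<in> charts_at A q" using q cA dA by (auto simp: charts_at_iff)
    then have "Y q d = Dtr c d q (Y q c)"
      using vector_fieldD(1)[OF Y(1)] point_of_chart by (intro tangent_Dtr) auto
    then show "?Yd (?\<phi> x) = frechet_derivative ?\<phi> (at x) (?Yc x)"
      using q cA dA by simp
  qed
  ultimately have D: "?DYd (Dtr c d p v) = D2tr c d p v w + Dtr c d p (?DYc v)" for v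
    by (rule fun_cong[OF has_derivative_unique, symmetric])
  have Xp: "X p c = u" "X p d = Dtr c d p u" and Yp: "Y p c = w" "Y p d = Dtr c d p w"
    using X(2) Y(2) c d by (simp_all add: coord_vec_eq)
  have "D X Y p d = Dtr c d p (D X Y p c)"
    using vector_fieldD(1)[OF connection_field[OF X(1) Y(1)] pA] c d by (rule tangent_Dtr)
  then have "?DYd (Dtr c d p u) + gam d p (Dtr c d p u) (Dtr c d p w) = Dtr c d p (?DYc u) + Dtr c d p (gam c p u w)"
    unfolding connection_local[OF c X(1) Y(1)] connection_local[OF d X(1) Y(1)] Xp Yp
    by (simp add: linear_add[OF linear_Dtr[OF c d]])
  then show ?thesis by (simp add: D algebra_simps)
qed

end

section \<open>Horizontal and vertical lifts\<close>

lemma tensor_field_11D: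
  assumes "tensor_field_11 B J"
  shows "p \<in> points B \<Longrightarrow> v \<in> tangent_space B p \<Longrightarrow> J p v \<in> tangent_space B p"
    "p \<in> points B \<Longrightarrow> v \<in> tangent_space B p \<Longrightarrow> w \<in> tangent_space B p \<Longrightarrow>
      J p (a *\<^sub>R v + b *\<^sub>R w) = a *\<^sub>R J p v + b *\<^sub>R J p w"
    "\<not> (p \<in> points B \<and> v \<in> tangent_space B p) \<Longrightarrow> J p v = 0"
  using assms unfolding tensor_field_11_def by simp_all

lemma tensor_field_02D:
  assumes "tensor_field_02 B g"
  shows "p \<in> points B \<Longrightarrow> u \<in> tangent_space B p \<Longrightarrow> v \<in> tangent_space B p \<Longrightarrow> w \<in> tangent_space B p \<Longrightarrow>
      g p (a *\<^sub>R u + b *\<^sub>R v) w = a * g p u w + b * g p v w"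
    "p \<in> points B \<Longrightarrow> u \<in> tangent_space B p \<Longrightarrow> v \<in> tangent_space B p \<Longrightarrow> w \<in> tangent_space B p \<Longrightarrow>
      g p w (a *\<^sub>R u + b *\<^sub>R v) = a * g p w u + b * g p w v"
    "\<not> (p \<in> points B \<and> v \<in> tangent_space B p \<and> w \<in> tangent_space B p) \<Longrightarrow> g p v w = 0"
    "c \<in> B \<Longrightarrow> smooth_on (cimg c) (\<lambda>x. g (cinv c x) (coord_vec B c (cinv c x) z) (coord_vec B c (cinv c x) z'))"
  using assms unfolding tensor_field_02_def by simp_all

context connection
begin

interpretation TA: atlas TA
  by unfold_locales (rule smooth_atlas_TA)

lemmas gam_linear_simps =
  linear_add[OF linear_gam_left] linear_scale[OF linear_gam_left] linear_0[OF linear_gam_left]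
  linear_add[OF linear_gam_right] linear_scale[OF linear_gam_right] linear_0[OF linear_gam_right]

lemma tangent_TA:
  assumes P: "P \<in> points TA" and V: "V \<in> tangent_space TA P"
    and c: "c \<in> charts_at A (fst P)" and d: "d \<in> charts_at A (fst P)"
  shows "V (tchart A d) = (Dtr c d (fst P) (fst (V (tchart A c))),
    D2tr c d (fst P) (fst (V (tchart A c))) (snd P c) + Dtr c d (fst P) (snd (V (tchart A c))))"
  using TA.tangent_Dtr[OF V tchart_at[OF P c] tchart_at[OF P d]]
    Dtr_TA[OF P c d, of "fst (V (tchart A c))" "snd (V (tchart A c))"] by simp

text \<open>\<open>hpart\<close> is the differential of the bundle projection and \<open>vpart\<close> is the connection map; \<open>lift\<close> is
  the inverse of the pair.\<close>

definition lift :: "'a \<times> ('a, 'e) tvec \<Rightarrow> ('a, 'e) tvec \<Rightarrow> ('a, 'e) tvec \<Rightarrow>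
    ('a \<times> ('a, 'e) tvec, 'e \<times> 'e) tvec" where
  "lift P u w = (\<lambda>C. if C \<in> charts_at TA P then
     (u (inv (tchart A) C), w (inv (tchart A) C) -
        gam (inv (tchart A) C) (fst P) (u (inv (tchart A) C)) (snd P (inv (tchart A) C))) else 0)"

definition hpart :: "'a \<times> ('a, 'e) tvec \<Rightarrow> ('a \<times> ('a, 'e) tvec, 'e \<times> 'e) tvec \<Rightarrow> ('a, 'e) tvec" where
  "hpart P V = (\<lambda>c. if c \<in> charts_at A (fst P) then fst (V (tchart A c)) else 0)"

definition vpart :: "'a \<times> ('a, 'e) tvec \<Rightarrow> ('a \<times> ('a, 'e) tvec, 'e \<times> 'e) tvec \<Rightarrow> ('a, 'e) tvec" where
  "vpart P V = (\<lambda>c. if c \<in> charts_at A (fst P)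
     then snd (V (tchart A c)) + gam c (fst P) (fst (V (tchart A c))) (snd P c) else 0)"

lemma lift_apply [simp]:
  "P \<in> points TA \<Longrightarrow> c \<in> charts_at A (fst P) \<Longrightarrow>
    lift P u w (tchart A c) = (u c, w c - gam c (fst P) (u c) (snd P c))"
  by (simp add: lift_def tchart_at inv_f_f[OF inj_tchart])

lemma lift_add: "lift P (u + u') (w + w') = lift P u w + lift P u' w'"
  by (rule ext) (simp add: lift_def gam_linear_simps)

lemma lift_scale: "lift P (a *\<^sub>R u) (a *\<^sub>R w) = a *\<^sub>R lift P u w"
  by (rule ext) (simp add: lift_def gam_linear_simps algebra_simps)

lemma linear_hpart: "linear (hpart P)"
  by (rule linearI; rule ext) (simp_all add: hpart_def)

lemma linear_vpart: "linear (vpart P)"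
  by (rule linearI; rule ext) (simp_all add: vpart_def gam_linear_simps algebra_simps)

context
  fixes P
  assumes P: "P \<in> points TA"
begin

lemma snd_P: "c \<in> charts_at A (fst P) \<Longrightarrow> d \<in> charts_at A (fst P) \<Longrightarrow> Dtr c d (fst P) (snd P c) = snd P d"
  using P tangent_Dtr[of "snd P" "fst P" c d] by (simp add: points_TA)

text \<open>The \<open>D2tr\<close> term in the Jacobian of the bundle transition is exactly the one
  produced by \<open>gam_transform\<close>, so subtracting the connection term gives components that
  transform as a tangent vector of the bundle.\<close>

lemma lift_in:
  assumes u: "u \<in> tangent_space A (fst P)" and w: "w \<in> tangent_space A (fst P)"
  shows "lift P u w \<in> tangent_space TA P"
proof (rule TA.tangentI)
  fix C D assume "C \<in> charts_at TA P" "D \<in> charts_at TA P"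
  then obtain c d where c: "c \<in> charts_at A (fst P)" "C = tchart A c" and d: "d \<in> charts_at A (fst P)" "D = tchart A d"
    unfolding charts_at_TA[OF P] by (elim bexE)
  show "lift P u w D = TA.Dtr C D P (lift P u w C)"
    using gam_transform[OF c(1) d(1), of "u c" "snd P c"] c d P
      Dtr_TA[OF P c(1) d(1), of "u c" "w c - gam c (fst P) (u c) (snd P c)"]
    by (simp add: snd_P linear_diff[OF linear_Dtr] tangent_Dtr[OF u c(1) d(1)] tangent_Dtr[OF w c(1) d(1)])
qed (simp add: lift_def)

lemma hpart_in:
  assumes V: "V \<in> tangent_space TA P"
  shows "hpart P V \<in> tangent_space A (fst P)"
proof (rule tangentI)
  fix c d assume "c \<in> charts_at A (fst P)" "d \<in> charts_at A (fst P)"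
  then show "hpart P V d = Dtr c d (fst P) (hpart P V c)"
    using tangent_TA[OF P V, of c d] by (simp add: hpart_def)
qed (simp add: hpart_def)

text \<open>The cancellation of \<open>lift_in\<close> in the other direction: adding the connection
  term removes \<open>D2tr\<close> and leaves the transformation law of the base.\<close>

lemma vpart_in:
  assumes V: "V \<in> tangent_space TA P"
  shows "vpart P V \<in> tangent_space A (fst P)"
proof (rule tangentI)
  fix c d assume c: "c \<in> charts_at A (fst P)" and d: "d \<in> charts_at A (fst P)"
  show "vpart P V d = Dtr c d (fst P) (vpart P V c)"
    using gam_transform[OF c d, of "fst (V (tchart A c))" "snd P c"] tangent_TA[OF P V c d] c d
    by (simp add: vpart_def snd_P linear_add[OF linear_Dtr])
qed (simp add: vpart_def)

lemma hpart_lift [simp]: "u \<in> tangent_space A (fst P) \<Longrightarrow> hpart P (lift P u w) = u"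
  by (rule ext) (simp add: hpart_def P tangent_outside)

lemma vpart_lift [simp]: "w \<in> tangent_space A (fst P) \<Longrightarrow> vpart P (lift P u w) = w"
  by (rule ext) (simp add: vpart_def P tangent_outside)

lemma chart_below:
  obtains c where "c \<in> charts_at A (fst P)"
proof -
  have "fst P \<in> points A" using P by (simp add: points_TA)
  then obtain c where "c \<in> charts_at A (fst P)" by (rule pointsE)
  then show ?thesis by (rule that)
qed

lemma lift_parts [simp]:
  assumes V: "V \<in> tangent_space TA P"
  shows "lift P (hpart P V) (vpart P V) = V"
proof -
  obtain c where c: "c \<in> charts_at A (fst P)" by (rule chart_below)
  show ?thesis
    by (rule TA.tangent_eqI[OF lift_in[OF hpart_in[OF V] vpart_in[OF V]] V tchart_at[OF P c]])
      (simp add: P c hpart_def vpart_def)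
qed

lemma bundle_field_eq:
  assumes V: "V \<in> tangent_space TA P" and eq: "\<And>c. c \<in> charts_at A (fst P) \<Longrightarrow> V (tchart A c) = Z c P"
  shows "bundle_field A Z P = V"
proof -
  obtain c where c: "c \<in> charts_at A (fst P)" by (rule chart_below)
  have "(THE V. V \<in> tangent_space TA P \<and> (\<forall>c\<in>charts_at A (fst P). V (tchart A c) = Z c P)) = V"
  proof (rule the_equality)
    show "V \<in> tangent_space TA P \<and> (\<forall>c\<in>charts_at A (fst P). V (tchart A c) = Z c P)"
      using V eq by simp
    fix V' assume V': "V' \<in> tangent_space TA P \<and> (\<forall>c\<in>charts_at A (fst P). V' (tchart A c) = Z c P)"
    show "V' = V"
      by (rule TA.tangent_eqI[OF conjunct1[OF V'] V tchart_at[OF P c]]) (use V' eq c in simp)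
  qed
  then show ?thesis by (simp add: bundle_field_def P)
qed

lemma hlift_eq:
  assumes "vector_field A X"
  shows "hlift A D X P = lift P (X (fst P)) 0"
proof -
  have "X (fst P) \<in> tangent_space A (fst P)" using vector_fieldD(1)[OF assms] P by (simp add: points_TA)
  then show ?thesis
    unfolding hlift_def
    by (intro bundle_field_eq lift_in subspace_0[OF subspace_tangent_space])
      (simp_all add: P gam_def split_beta)
qed

lemma vlift_eq:
  assumes "vector_field A X"
  shows "vlift A X P = lift P 0 (X (fst P))"
proof -
  have "X (fst P) \<in> tangent_space A (fst P)" using vector_fieldD(1)[OF assms] P by (simp add: points_TA)
  then show ?thesis
    unfolding vlift_def
    by (intro bundle_field_eq lift_in subspace_0[OF subspace_tangent_space])
      (simp_all add: P gam_linear_simps split_beta)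
qed

text \<open>Reduces a tensor on the bundle to its values on lifts of global fields, the only values
  prescribed by the definitions. The coefficients \<open>1\<close> match the linearity clauses of
  tensor fields.\<close>

lemma lifts_span:
  assumes V: "V \<in> tangent_space TA P"
  obtains X Y where "vector_field A X" "vector_field A Y" "X (fst P) = hpart P V" "Y (fst P) = vpart P V"
    "V = 1 *\<^sub>R hlift A D X P + 1 *\<^sub>R vlift A Y P"
    "hlift A D X P \<in> tangent_space TA P" "vlift A Y P \<in> tangent_space TA P"
proof -
  have p: "fst P \<in> points A" using P by (simp add: points_TA)
  obtain X where X: "vector_field A X" "X (fst P) = hpart P V"
    by (rule vector_field_through[OF p hpart_in[OF V]])
  obtain Y where Y: "vector_field A Y" "Y (fst P) = vpart P V"
    by (rule vector_field_through[OF p vpart_in[OF V]])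
  note 0 = subspace_0[OF subspace_tangent_space[of "fst P"]]
  show ?thesis
  proof (rule that[OF X(1) Y(1) X(2) Y(2)])
    show "V = 1 *\<^sub>R hlift A D X P + 1 *\<^sub>R vlift A Y P"
      unfolding hlift_eq[OF X(1)] vlift_eq[OF Y(1)] X(2) Y(2) scaleR_one lift_add[symmetric]
      by (simp only: add_0_left add_0_right lift_parts[OF V])
    show "hlift A D X P \<in> tangent_space TA P" "vlift A Y P \<in> tangent_space TA P"
      unfolding hlift_eq[OF X(1)] vlift_eq[OF Y(1)] X(2) Y(2)
      by (intro lift_in 0 hpart_in[OF V] vpart_in[OF V])+
  qed
qed

end

section \<open>The lifted endomorphisms\<close>

lemma cinv_tchart_point:
  assumes "c \<in> A" "z \<in> cimg (tchart A c)"
  shows "cinv (tchart A c) z \<in> points TA" "c \<in> charts_at A (fst (cinv (tchart A c) z))"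
    "fst (cinv (tchart A c) z) = cinv c (fst z)" "snd (cinv (tchart A c) z) c = snd z"
proof -
  have x: "fst z \<in> cimg c" using assms by (auto simp: cimg_tchart)
  have eq: "cinv (tchart A c) z = (cinv c (fst z), coord_vec A c (cinv c (fst z)) (snd z))"
    using cinv_tchart[OF assms(1) x, of "snd z"] by simp
  have c: "c \<in> charts_at A (cinv c (fst z))" using x assms(1) cinv_in by (simp add: charts_at_iff)
  show "cinv (tchart A c) z \<in> points TA" "c \<in> charts_at A (fst (cinv (tchart A c) z))"
    "fst (cinv (tchart A c) z) = cinv c (fst z)" "snd (cinv (tchart A c) z) c = snd z"
    unfolding eq using c point_of_chart[OF c] by (simp_all add: points_TA)
qed

text \<open>The value \<open>0\<close> off the tangent spaces is the convention of
  \<open>tensor_field_11\<close>; it allows the identification with \<open>lift_structure\<close> as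
  an equality of functions.\<close>

definition lift_endo :: "real \<Rightarrow> 'a \<times> ('a, 'e) tvec \<Rightarrow> ('a \<times> ('a, 'e) tvec, 'e \<times> 'e) tvec \<Rightarrow>
    ('a \<times> ('a, 'e) tvec, 'e \<times> 'e) tvec" where
  "lift_endo s P V = (if P \<in> points TA \<and> V \<in> tangent_space TA P
     then lift P (s *\<^sub>R vpart P V) (hpart P V) else 0)"

lemma smooth_on_coords:
  assumes "c \<in> A"
  shows "open (cimg (tchart A c))" "smooth_on (cimg (tchart A c)) fst" "smooth_on (cimg (tchart A c)) snd"
    "fst ` cimg (tchart A c) \<subseteq> cimg c"
proof -
  show O: "open (cimg (tchart A c))" using TA.open_cimg[OF tchart_in[OF assms]] .
  show "smooth_on (cimg (tchart A c)) fst" "smooth_on (cimg (tchart A c)) snd"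
    using smooth_on_fst[OF O smooth_on_id[OF O]] smooth_on_snd[OF O smooth_on_id[OF O]] by simp_all
  show "fst ` cimg (tchart A c) \<subseteq> cimg c" using assms by (auto simp: cimg_tchart)
qed

lemma parts_coord_vec:
  assumes "P \<in> points TA" "c \<in> charts_at A (fst P)"
  shows "hpart P (coord_vec TA (tchart A c) P w) c = fst w"
    "vpart P (coord_vec TA (tchart A c) P w) c = snd w + gam c (fst P) (fst w) (snd P c)"
  using assms tchart_at[OF assms] by (simp_all add: hpart_def vpart_def)

lemma tensor_field_lift_endo: "tensor_field_11 TA (lift_endo s)"
  unfolding tensor_field_11_def
proof (intro conjI ballI allI impI)
  fix P V assume P: "P \<in> points TA" and V: "V \<in> tangent_space TA P"
  show "lift_endo s P V \<in> tangent_space TA P"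
    using P V by (simp add: lift_endo_def lift_in hpart_in vpart_in subspace_scale[OF subspace_tangent_space])
  fix W a b assume W: "W \<in> tangent_space TA P"
  have "a *\<^sub>R V + b *\<^sub>R W \<in> tangent_space TA P"
    using V W by (intro subspace_add subspace_scale TA.subspace_tangent_space)
  then show "lift_endo s P (a *\<^sub>R V + b *\<^sub>R W) = a *\<^sub>R lift_endo s P V + b *\<^sub>R lift_endo s P W"
    using P V W
    by (simp add: lift_endo_def linear_add[OF linear_hpart] linear_scale[OF linear_hpart]
        linear_add[OF linear_vpart] linear_scale[OF linear_vpart] scaleR_add_right
        lift_add lift_scale[symmetric] mult.commute[of s])
next
  fix P V assume "P \<notin> points TA \<or> V \<notin> tangent_space TA P"
  then show "lift_endo s P V = 0" by (auto simp: lift_endo_def)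
next
  fix C w assume "C \<in> TA"
  then obtain c where C: "c \<in> A" "C = tchart A c" by (auto simp: tangent_bundle_def)
  note co = smooth_on_coords[OF C(1)]
  let ?v = "\<lambda>z. snd w + gam c (cinv c (fst z)) (fst w) (snd z)"
  have v: "smooth_on (cimg C) ?v"
    unfolding C by (intro smooth_on_add smooth_gam co C smooth_on_const)
  have 1: "smooth_on (cimg C) (\<lambda>z. s *\<^sub>R ?v z)"
    by (rule smooth_on_scaleR[OF _ smooth_on_const v]) (simp add: C co)
  \<comment> \<open>The endomorphism in induced coordinates: \<open>(a, b)\<close> has vertical part
    \<open>v = b + \<Gamma>(a, y)\<close>, and lifting the pair \<open>(s v, a)\<close> gives
    \<open>(s v, a - \<Gamma>(s v, y))\<close>.\<close>
  have 2: "smooth_on (cimg C) (\<lambda>z. (s *\<^sub>R ?v z, fst w - gam c (cinv c (fst z)) (s *\<^sub>R ?v z) (snd z)))"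
    using 1 unfolding C by (intro smooth_on_Pair smooth_on_diff smooth_gam co C smooth_on_const)
  show "smooth_on (cimg C) (\<lambda>x. lift_endo s (cinv C x) (coord_vec TA C (cinv C x) w) C)"
  proof (rule smooth_on_cong[OF _ _ 2])
    show "open (cimg C)" by (simp add: C co)
    fix z assume z: "z \<in> cimg C"
    let ?P = "cinv C z"
    note P = cinv_tchart_point[OF C(1) z[unfolded C(2)], folded C(2)]
    have "coord_vec TA C ?P w \<in> tangent_space TA ?P"
      using tchart_at[OF P(1,2)] by (simp add: C(2)[symmetric])
    then have "lift_endo s ?P (coord_vec TA C ?P w) C =
        lift ?P (s *\<^sub>R vpart ?P (coord_vec TA C ?P w)) (hpart ?P (coord_vec TA C ?P w)) (tchart A c)"
      using P(1) by (simp add: lift_endo_def C(2)[symmetric])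
    then show "(s *\<^sub>R ?v z, fst w - gam c (cinv c (fst z)) (s *\<^sub>R ?v z) (snd z)) =
        lift_endo s ?P (coord_vec TA C ?P w) C"
      using P parts_coord_vec[OF P(1,2), folded C(2), of w] by simp
  qed
qed

text \<open>Two tensors with the prescribed values agree on tangent vectors by linearity and
  \<open>lifts_span\<close>, and both vanish elsewhere.\<close>

lemma lift_structure_eq: "lift_structure s A D = lift_endo s"
  unfolding lift_structure_def
proof (rule the_equality)
  have "lift_endo s P (hlift A D X P) = vlift A X P" "lift_endo s P (vlift A X P) = s *\<^sub>R hlift A D X P"
    if X: "vector_field A X" and P: "P \<in> points TA" for X P
  proof -
    have "X (fst P) \<in> tangent_space A (fst P)" using vector_fieldD(1)[OF X] P by (simp add: points_TA)
    moreover note 0 = subspace_0[OF subspace_tangent_space[of "fst P"]]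
    ultimately show "lift_endo s P (hlift A D X P) = vlift A X P" "lift_endo s P (vlift A X P) = s *\<^sub>R hlift A D X P"
      using lift_scale[of P s "X (fst P)" 0] P by (simp_all add: hlift_eq[OF P X] vlift_eq[OF P X] lift_endo_def lift_in)
  qed
  then show "tensor_field_11 TA (lift_endo s) \<and> (\<forall>X. vector_field A X \<longrightarrow> (\<forall>P\<in>points TA.
      lift_endo s P (hlift A D X P) = vlift A X P \<and> lift_endo s P (vlift A X P) = s *\<^sub>R hlift A D X P))"
    using tensor_field_lift_endo by simp
next
  fix J assume "tensor_field_11 TA J \<and> (\<forall>X. vector_field A X \<longrightarrow> (\<forall>P\<in>points TA.
      J P (hlift A D X P) = vlift A X P \<and> J P (vlift A X P) = s *\<^sub>R hlift A D X P))"
  then have tJ: "tensor_field_11 TA J"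
    and J: "\<And>X P. vector_field A X \<Longrightarrow> P \<in> points TA \<Longrightarrow> J P (hlift A D X P) = vlift A X P"
      "\<And>X P. vector_field A X \<Longrightarrow> P \<in> points TA \<Longrightarrow> J P (vlift A X P) = s *\<^sub>R hlift A D X P"
    by simp_all
  show "J = lift_endo s"
  proof (rule ext, rule ext)
    fix P V
    show "J P V = lift_endo s P V"
    proof (cases "P \<in> points TA \<and> V \<in> tangent_space TA P")
      case True
      then have P: "P \<in> points TA" and V: "V \<in> tangent_space TA P" by simp_all
      obtain X Y where X: "vector_field A X" and Y: "vector_field A Y"
        and XY: "X (fst P) = hpart P V" "Y (fst P) = vpart P V"
        and Veq: "V = 1 *\<^sub>R hlift A D X P + 1 *\<^sub>R vlift A Y P"
        and in_TA: "hlift A D X P \<in> tangent_space TA P" "vlift A Y P \<in> tangent_space TA P"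
        by (rule lifts_span[OF P V])
      have "J P V = 1 *\<^sub>R J P (hlift A D X P) + 1 *\<^sub>R J P (vlift A Y P)"
        by (subst Veq) (rule tensor_field_11D(2)[OF tJ P in_TA])
      also have "\<dots> = s *\<^sub>R lift P (vpart P V) 0 + lift P 0 (hpart P V)"
        unfolding J[OF X P] J[OF Y P] hlift_eq[OF P Y] vlift_eq[OF P X] XY by (simp only: scaleR_one add.commute)
      also have "\<dots> = lift P (s *\<^sub>R vpart P V) (hpart P V)"
        unfolding lift_scale[symmetric] lift_add[symmetric] by (simp only: scaleR_zero_right add_0_left add_0_right)
      finally show ?thesis using True by (simp add: lift_endo_def)
    next
      case False
      then show ?thesis using tensor_field_11D(3)[OF tJ] by (simp only: lift_endo_def if_False)
    qed
  qed
qed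

lemma lift_endo_in:
  "P \<in> points TA \<Longrightarrow> V \<in> tangent_space TA P \<Longrightarrow> lift_endo s P V \<in> tangent_space TA P"
  by (rule tensor_field_11D(1)[OF tensor_field_lift_endo])

lemma parts_lift_endo:
  assumes "P \<in> points TA" "V \<in> tangent_space TA P"
  shows "hpart P (lift_endo s P V) = s *\<^sub>R vpart P V" "vpart P (lift_endo s P V) = hpart P V"
  using assms by (simp_all add: lift_endo_def hpart_in vpart_in subspace_scale[OF subspace_tangent_space])

lemma lift_endo_twice:
  assumes "P \<in> points TA" "V \<in> tangent_space TA P"
  shows "lift_endo s P (lift_endo s P V) = s *\<^sub>R V"
  using assms lift_endo_in[OF assms]
  by (simp add: lift_endo_def[of s P "lift_endo s P V"] parts_lift_endo lift_scale)

end

section \<open>The horizontal lift metric\<close>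

text \<open>Tangent vectors are functions on charts and their type is not a Euclidean space.
  Dimensions of their subspaces are therefore obtained from linear injections: into the model space
  for upper bounds here, and from it for exact values in \<open>dim_range\<close>.\<close>

lemma dim_le_DIM:
  fixes f :: "'b::real_vector \<Rightarrow> 'e::euclidean_space"
  assumes f: "linear f" and W: "subspace W" and inj: "inj_on f W"
  shows "dim W \<le> DIM('e)"
proof -
  obtain B where B: "B \<subseteq> W" "independent B" "W \<subseteq> span B" "card B = dim W"
    by (rule real_vector.basis_exists[of W])
  have "span B \<subseteq> W" using B(1) W by (rule span_minimal)
  then have "inj_on f (span B)" using inj inj_on_subset by blast
  then have "independent (f ` B)"
    by (rule linear_independent_injective_image[OF f B(2)])
  then have "card (f ` B) \<le> DIM('e)" by (simp add: independent_bound)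
  moreover have "card (f ` B) = card B"
    using inj B(1) by (intro card_image) (rule inj_on_subset)
  ultimately show ?thesis using B(4) by simp
qed

lemma dim_range:
  fixes g :: "'e::euclidean_space \<Rightarrow> 'b::real_vector"
  assumes g: "linear g" and inj: "inj g"
  shows "dim (range g) = DIM('e)"
proof -
  have "independent (g ` Basis)"
    by (rule linear_independent_injective_image[OF g independent_Basis inj_on_subset[OF inj subset_UNIV]])
  moreover have "span (g ` Basis) = range g"
    using linear_span_image[OF g, of Basis] by simp
  ultimately have "dim (range g) = card (g ` Basis)"
    by (metis dim_span real_vector.dim_eq_card_independent)
  also have "\<dots> = DIM('e)" using inj by (intro card_image) (rule inj_on_subset, auto)
  finally show ?thesis .
qed

locale lifted_metric = connection A D for A :: "('a, 'e::euclidean_space) chart set" and D +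
  fixes h :: "'a \<Rightarrow> ('a, 'e) tvec \<Rightarrow> ('a, 'e) tvec \<Rightarrow> real"
  assumes metric: "pseudo_riemannian_manifold A h"
begin

interpretation TA: atlas TA
  by unfold_locales (rule smooth_atlas_TA)

lemma tensor_h: "tensor_field_02 A h"
  using metric by (simp add: pseudo_riemannian_manifold_def)

lemma h_sym: "p \<in> points A \<Longrightarrow> v \<in> tangent_space A p \<Longrightarrow> w \<in> tangent_space A p \<Longrightarrow> h p v w = h p w v"
  using metric by (simp add: pseudo_riemannian_manifold_def)

lemma h_nondegenerate:
  "p \<in> points A \<Longrightarrow> v \<in> tangent_space A p \<Longrightarrow> (\<And>w. w \<in> tangent_space A p \<Longrightarrow> h p v w = 0) \<Longrightarrow> v = 0"
  using metric by (simp add: pseudo_riemannian_manifold_def)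

lemma h_add:
  assumes "p \<in> points A" "u \<in> tangent_space A p" "v \<in> tangent_space A p" "w \<in> tangent_space A p"
  shows "h p (u + v) w = h p u w + h p v w" "h p w (u + v) = h p w u + h p w v"
  using tensor_field_02D(1)[OF tensor_h assms, of 1 1] tensor_field_02D(2)[OF tensor_h assms, of 1 1]
  by simp_all

lemma h_scale:
  assumes "p \<in> points A" "u \<in> tangent_space A p" "w \<in> tangent_space A p"
  shows "h p (a *\<^sub>R u) w = a * h p u w" "h p w (a *\<^sub>R u) = a * h p w u"
  using tensor_field_02D(1)[OF tensor_h assms(1,2,2,3), of a 0] tensor_field_02D(2)[OF tensor_h assms(1,2,2,3), of a 0]
  by simp_all

lemma h_zero:
  assumes "p \<in> points A" "w \<in> tangent_space A p"
  shows "h p 0 w = 0" "h p w 0 = 0"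
  using h_scale[OF assms(1,2,2), of 0] by simp_all

lemma linear_h_coord:
  assumes c: "c \<in> charts_at A p" and v: "v \<in> tangent_space A p"
  shows "linear (\<lambda>w. h p v (coord_vec A c p w))" "linear (\<lambda>w. h p (coord_vec A c p w) v)"
  using h_add[OF point_of_chart[OF c] _ _ v] h_scale[OF point_of_chart[OF c] _ v] c
  by (auto intro!: linearI simp: linear_add[OF linear_coord_vec[OF c]] linear_scale[OF linear_coord_vec[OF c]])

text \<open>A tensor field is known to be smooth for constant components; the basis expansion of
  \<open>smooth_on_linear_family\<close> is applied once for each argument.\<close>

lemma smooth_h:
  fixes S :: "'s::euclidean_space set"
  assumes c: "c \<in> A" and S: "open S" and x: "smooth_on S x" "x ` S \<subseteq> cimg c"
    and u: "smooth_on S u" and w: "smooth_on S w"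
  shows "smooth_on S (\<lambda>z. h (cinv c (x z)) (coord_vec A c (cinv c (x z)) (u z)) (coord_vec A c (cinv c (x z)) (w z)))"
proof -
  have ch: "c \<in> charts_at A (cinv c (x z))" if "z \<in> S" for z
    using that x(2) c cinv_in[OF c] by (auto simp: charts_at_iff)
  have "smooth_on S (\<lambda>z. h (cinv c (x z)) (coord_vec A c (cinv c (x z)) a) (coord_vec A c (cinv c (x z)) b))" for a b
    by (rule smooth_on_compose[OF S open_cimg[OF c] x(2,1) tensor_field_02D(4)[OF tensor_h c]])
  then have 1: "smooth_on S (\<lambda>z. h (cinv c (x z)) (coord_vec A c (cinv c (x z)) a) (coord_vec A c (cinv c (x z)) (w z)))" for a
    using linear_h_coord(1)[OF ch coord_vec_in[OF ch]]
    by (intro smooth_on_linear_family[where L = "\<lambda>z b. h (cinv c (x z)) (coord_vec A c (cinv c (x z)) a)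
      (coord_vec A c (cinv c (x z)) b)", OF S _ _ w])
  show ?thesis
    using linear_h_coord(2)[OF ch coord_vec_in[OF ch]]
    by (intro smooth_on_linear_family[where L = "\<lambda>z b. h (cinv c (x z)) (coord_vec A c (cinv c (x z)) b)
      (coord_vec A c (cinv c (x z)) (w z))", OF S _ 1 u])
qed

definition metric_lift :: "'a \<times> ('a, 'e) tvec \<Rightarrow> ('a \<times> ('a, 'e) tvec, 'e \<times> 'e) tvec \<Rightarrow>
    ('a \<times> ('a, 'e) tvec, 'e \<times> 'e) tvec \<Rightarrow> real" where
  "metric_lift P V W = (if P \<in> points TA \<and> V \<in> tangent_space TA P \<and> W \<in> tangent_space TA P
     then h (fst P) (hpart P V) (vpart P W) + h (fst P) (vpart P V) (hpart P W) else 0)"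

lemma points_TA_fst: "P \<in> points TA \<Longrightarrow> fst P \<in> points A"
  by (simp add: points_TA)

lemma tensor_field_metric_lift: "tensor_field_02 TA metric_lift"
  unfolding tensor_field_02_def
proof (intro conjI ballI allI impI)
  fix P U V W a b assume P: "P \<in> points TA" and U: "U \<in> tangent_space TA P" and V: "V \<in> tangent_space TA P"
    and W: "W \<in> tangent_space TA P"
  have UV: "a *\<^sub>R U + b *\<^sub>R V \<in> tangent_space TA P"
    using U V by (intro subspace_add subspace_scale TA.subspace_tangent_space)
  note lin = linear_add[OF linear_hpart] linear_scale[OF linear_hpart]
    linear_add[OF linear_vpart] linear_scale[OF linear_vpart]
  note mem = points_TA_fst[OF P] hpart_in[OF P U] hpart_in[OF P V] hpart_in[OF P W]
    vpart_in[OF P U] vpart_in[OF P V] vpart_in[OF P W]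
  show "metric_lift P (a *\<^sub>R U + b *\<^sub>R V) W = a * metric_lift P U W + b * metric_lift P V W"
    "metric_lift P W (a *\<^sub>R U + b *\<^sub>R V) = a * metric_lift P W U + b * metric_lift P W V"
    using P U V W UV mem
    by (simp_all add: metric_lift_def lin tensor_field_02D(1,2)[OF tensor_h] algebra_simps)
next
  fix P V W assume "P \<notin> points TA \<or> V \<notin> tangent_space TA P \<or> W \<notin> tangent_space TA P"
  then show "metric_lift P V W = 0" unfolding metric_lift_def by argo
next
  fix C v w assume "C \<in> TA"
  then obtain c where C: "c \<in> A" "C = tchart A c" by (auto simp: tangent_bundle_def)
  note co = smooth_on_coords[OF C(1)]
  let ?v = "\<lambda>v z. snd v + gam c (cinv c (fst z)) (fst v) (snd z)"
  let ?h = "\<lambda>z u w. h (cinv c (fst z)) (coord_vec A c (cinv c (fst z)) u) (coord_vec A c (cinv c (fst z)) w)"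
  have v: "smooth_on (cimg C) (?v v)" for v
    unfolding C by (intro smooth_on_add smooth_gam co C smooth_on_const)
  have 1: "smooth_on (cimg C) (\<lambda>z. ?h z (fst v) (?v w z) + ?h z (?v v z) (fst w))"
    using smooth_h[OF C(1) co(1,2,4) smooth_on_const v[unfolded C(2)]]
      smooth_h[OF C(1) co(1,2,4) v[unfolded C(2)] smooth_on_const]
    unfolding C(2) by (intro smooth_on_add co)
  show "smooth_on (cimg C) (\<lambda>x. metric_lift (cinv C x) (coord_vec TA C (cinv C x) v) (coord_vec TA C (cinv C x) w))"
  proof (rule smooth_on_cong[OF _ _ 1])
    show "open (cimg C)" by (simp add: C co)
    fix z assume z: "z \<in> cimg C"
    let ?P = "cinv C z"
    note P = cinv_tchart_point[OF C(1) z[unfolded C(2)], folded C(2)]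
    have in_TA: "coord_vec TA C ?P v \<in> tangent_space TA ?P" for v
      using tchart_at[OF P(1,2)] by (simp add: C(2)[symmetric])
    have "hpart ?P (coord_vec TA C ?P v) = coord_vec A c (cinv c (fst z)) (fst v)"
      "vpart ?P (coord_vec TA C ?P v) = coord_vec A c (cinv c (fst z)) (?v v z)" for v
      using coord_vec_component[OF hpart_in[OF P(1) in_TA[of v]] P(2)]
        coord_vec_component[OF vpart_in[OF P(1) in_TA[of v]] P(2)]
      by (simp_all add: parts_coord_vec[OF P(1,2), folded C(2)] P(3,4))
    then show "?h z (fst v) (?v w z) + ?h z (?v v z) (fst w) =
        metric_lift ?P (coord_vec TA C ?P v) (coord_vec TA C ?P w)"
      using P(1) in_TA by (simp add: metric_lift_def P(3))
  qed
qed

lemma metric_lift_lift: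
  assumes "P \<in> points TA" "u \<in> tangent_space A (fst P)" "w \<in> tangent_space A (fst P)"
    "u' \<in> tangent_space A (fst P)" "w' \<in> tangent_space A (fst P)"
  shows "metric_lift P (lift P u w) (lift P u' w') = h (fst P) u w' + h (fst P) w u'"
  using assms by (simp add: metric_lift_def lift_in)

lemma metric_lift_hv:
  assumes X: "vector_field A X" and Y: "vector_field A Y" and P: "P \<in> points TA"
  shows "metric_lift P (hlift A D X P) (hlift A D Y P) = 0" "metric_lift P (vlift A X P) (vlift A Y P) = 0"
    "metric_lift P (hlift A D X P) (vlift A Y P) = h (fst P) (X (fst P)) (Y (fst P))"
    "metric_lift P (vlift A Y P) (hlift A D X P) = h (fst P) (X (fst P)) (Y (fst P))"
proof -
  note p = points_TA_fst[OF P]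
  note XY = vector_fieldD(1)[OF X p] vector_fieldD(1)[OF Y p] subspace_0[OF subspace_tangent_space[of "fst P"]]
  show "metric_lift P (hlift A D X P) (hlift A D Y P) = 0" "metric_lift P (vlift A X P) (vlift A Y P) = 0"
    "metric_lift P (hlift A D X P) (vlift A Y P) = h (fst P) (X (fst P)) (Y (fst P))"
    "metric_lift P (vlift A Y P) (hlift A D X P) = h (fst P) (X (fst P)) (Y (fst P))"
    unfolding hlift_eq[OF P X] hlift_eq[OF P Y] vlift_eq[OF P X] vlift_eq[OF P Y]
    using p P XY h_sym[OF p XY(1,2)] by (simp_all add: metric_lift_lift h_zero)
qed

lemma hlift_metric_eq: "hlift_metric A D h = metric_lift"
  unfolding hlift_metric_def
proof (rule the_equality)
  show "tensor_field_02 TA metric_lift \<and> (\<forall>X Y. vector_field A X \<and> vector_field A Y \<longrightarrow> (\<forall>P\<in>points TA.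
        metric_lift P (hlift A D X P) (hlift A D Y P) = 0 \<and>
        metric_lift P (vlift A X P) (vlift A Y P) = 0 \<and>
        metric_lift P (hlift A D X P) (vlift A Y P) = h (fst P) (X (fst P)) (Y (fst P)) \<and>
        metric_lift P (vlift A Y P) (hlift A D X P) = h (fst P) (X (fst P)) (Y (fst P))))"
    using tensor_field_metric_lift metric_lift_hv by simp
next
  fix G assume "tensor_field_02 TA G \<and> (\<forall>X Y. vector_field A X \<and> vector_field A Y \<longrightarrow> (\<forall>P\<in>points TA.
        G P (hlift A D X P) (hlift A D Y P) = 0 \<and>
        G P (vlift A X P) (vlift A Y P) = 0 \<and>
        G P (hlift A D X P) (vlift A Y P) = h (fst P) (X (fst P)) (Y (fst P)) \<and>
        G P (vlift A Y P) (hlift A D X P) = h (fst P) (X (fst P)) (Y (fst P))))"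
  then have tG: "tensor_field_02 TA G"
    and G: "\<And>X Y P. vector_field A X \<Longrightarrow> vector_field A Y \<Longrightarrow> P \<in> points TA \<Longrightarrow> G P (hlift A D X P) (hlift A D Y P) = 0"
      "\<And>X Y P. vector_field A X \<Longrightarrow> vector_field A Y \<Longrightarrow> P \<in> points TA \<Longrightarrow> G P (vlift A X P) (vlift A Y P) = 0"
      "\<And>X Y P. vector_field A X \<Longrightarrow> vector_field A Y \<Longrightarrow> P \<in> points TA \<Longrightarrow>
        G P (hlift A D X P) (vlift A Y P) = h (fst P) (X (fst P)) (Y (fst P))"
      "\<And>X Y P. vector_field A X \<Longrightarrow> vector_field A Y \<Longrightarrow> P \<in> points TA \<Longrightarrow>
        G P (vlift A Y P) (hlift A D X P) = h (fst P) (X (fst P)) (Y (fst P))"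
    by simp_all
  show "G = metric_lift"
  proof (rule ext, rule ext, rule ext)
    fix P V W
    show "G P V W = metric_lift P V W"
    proof (cases "P \<in> points TA \<and> V \<in> tangent_space TA P \<and> W \<in> tangent_space TA P")
      case True
      then have P: "P \<in> points TA" and V: "V \<in> tangent_space TA P" and W: "W \<in> tangent_space TA P" by simp_all
      obtain X Y where X: "vector_field A X" and Y: "vector_field A Y"
        and XY: "X (fst P) = hpart P V" "Y (fst P) = vpart P V"
        and Veq: "V = 1 *\<^sub>R hlift A D X P + 1 *\<^sub>R vlift A Y P"
        and V_in: "hlift A D X P \<in> tangent_space TA P" "vlift A Y P \<in> tangent_space TA P"
        by (rule lifts_span[OF P V])
      obtain X' Y' where X': "vector_field A X'" and Y': "vector_field A Y'"
        and XY': "X' (fst P) = hpart P W" "Y' (fst P) = vpart P W"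
        and Weq: "W = 1 *\<^sub>R hlift A D X' P + 1 *\<^sub>R vlift A Y' P"
        and W_in: "hlift A D X' P \<in> tangent_space TA P" "vlift A Y' P \<in> tangent_space TA P"
        by (rule lifts_span[OF P W])
      have "G P V W = 1 * G P (hlift A D X P) W + 1 * G P (vlift A Y P) W"
        by (subst Veq) (rule tensor_field_02D(1)[OF tG P V_in W])
      also have "G P (hlift A D X P) W = 1 * G P (hlift A D X P) (hlift A D X' P) + 1 * G P (hlift A D X P) (vlift A Y' P)"
        by (subst Weq) (rule tensor_field_02D(2)[OF tG P W_in V_in(1)])
      also have "G P (vlift A Y P) W = 1 * G P (vlift A Y P) (hlift A D X' P) + 1 * G P (vlift A Y P) (vlift A Y' P)"
        by (subst Weq) (rule tensor_field_02D(2)[OF tG P W_in V_in(2)])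
      finally have "G P V W = h (fst P) (hpart P V) (vpart P W) + h (fst P) (hpart P W) (vpart P V)"
        by (simp add: G(1)[OF X X' P] G(2)[OF Y Y' P] G(3)[OF X Y' P] G(4)[OF X' Y P] XY XY')
      \<comment> \<open>The prescribed value on a vertical and a horizontal lift has the horizontal
        vector as first argument of \<open>h\<close>, whereas \<open>metric_lift\<close> has it
        second; symmetry of \<open>h\<close> reconciles them.\<close>
      then show ?thesis
        using True h_sym[OF points_TA_fst[OF P] hpart_in[OF P W] vpart_in[OF P V]] by (simp add: metric_lift_def)
    next
      case False
      then show ?thesis using tensor_field_02D(3)[OF tG] by (simp only: metric_lift_def if_False)
    qed
  qed
qed

section \<open>Index and nondegeneracy of the lifted metric\<close>

lemma linear_lift_coord:
  assumes "linear f" "linear g" "c \<in> charts_at A p"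
  shows "linear (\<lambda>a. lift P (coord_vec A c p (f a)) (coord_vec A c p (g a)))"
  by (rule linearI)
    (simp_all add: linear_add[OF assms(1)] linear_scale[OF assms(1)] linear_add[OF assms(2)] linear_scale[OF assms(2)]
      linear_add[OF linear_coord_vec[OF assms(3)]] linear_scale[OF linear_coord_vec[OF assms(3)]] lift_add lift_scale)

text \<open>The first component in the induced chart already returns \<open>a\<close>, whatever
  \<open>g\<close> is. One statement thus serves the negative definite subspace and both
  eigenspaces.\<close>

lemma inj_lift_coord:
  assumes P: "P \<in> points TA" and c: "c \<in> charts_at A (fst P)"
  shows "inj (\<lambda>a. lift P (coord_vec A c (fst P) a) (coord_vec A c (fst P) (g a)))"
proof (rule injI)
  fix a b
  assume "lift P (coord_vec A c (fst P) a) (coord_vec A c (fst P) (g a)) =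
    lift P (coord_vec A c (fst P) b) (coord_vec A c (fst P) (g b))"
  then have "fst (lift P (coord_vec A c (fst P) a) (coord_vec A c (fst P) (g a)) (tchart A c)) =
    fst (lift P (coord_vec A c (fst P) b) (coord_vec A c (fst P) (g b)) (tchart A c))" by (rule arg_cong)
  then show "a = b" using P c by simp
qed

text \<open>In coordinates, \<open>S\<close> is the inverse Gram matrix of \<open>h\<close>.\<close>

lemma metric_dual:
  assumes c: "c \<in> charts_at A p"
  obtains S :: "'e \<Rightarrow> 'e" where "linear S"
    "\<forall>a. h p (coord_vec A c p a) (coord_vec A c p (S a)) = a \<bullet> a"
proof -
  note p = point_of_chart[OF c]
  let ?B = "\<lambda>u w. h p (coord_vec A c p u) (coord_vec A c p w)"
  \<comment> \<open>The Gram map: \<open>L u\<close> represents the functional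
    \<open>h(u, .)\<close> by the Euclidean inner product. Nondegeneracy makes it injective, hence
    onto in finite dimension.\<close>
  define L where "L = (\<lambda>u. \<Sum>b\<in>Basis. ?B u b *\<^sub>R b)"
  have linB: "linear (?B u)" "linear (\<lambda>u. ?B u w)" for u w
    using linear_h_coord[OF c coord_vec_in[OF c]] by simp_all
  have L: "L u \<bullet> w = ?B u w" for u w
  proof -
    have "L u \<bullet> w = (\<Sum>b\<in>Basis. (w \<bullet> b) *\<^sub>R ?B u b)"
      unfolding L_def inner_sum_left by (intro sum.cong) (simp_all add: inner_commute)
    also have "\<dots> = ?B u w" by (rule linear_expand[OF linB(1), symmetric])
    finally show ?thesis .
  qed
  have linL: "linear L"
    by (rule linearI)
      (simp_all add: L_def linear_add[OF linB(2)] linear_scale[OF linB(2)] scaleR_add_left sum.distrib scaleR_sum_right)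
  have "inj L"
    unfolding linear_injective_0[OF linL]
  proof (intro allI impI)
    fix u assume "L u = 0"
    then have "?B u w = 0" for w using L[of u w] by simp
    then have "coord_vec A c p u = 0"
      using c by (intro h_nondegenerate[OF p]) (simp, metis coord_vec_component)
    then show "u = 0" using coord_vec_self[OF c, of u] by simp
  qed
  then obtain S where S: "linear S" "L \<circ> S = id"
    using linear_surjective_right_inverse[OF linL] linear_injective_imp_surjective[OF linL] by auto
  have "?B a (S a) = a \<bullet> a" for a
  proof -
    have "?B a (S a) = ?B (S a) a" using c by (intro h_sym p) simp_all
    also have "\<dots> = L (S a) \<bullet> a" by (simp add: L)
    finally show ?thesis using S(2) by (simp add: fun_eq_iff)
  qed
  then show ?thesis using that[OF S(1)] by simp
qed

lemma metric_index_lift: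
  assumes P: "P \<in> points TA"
  shows "metric_index TA metric_lift P = DIM('e)"
proof -
  obtain c where c: "c \<in> charts_at A (fst P)" by (rule chart_below[OF P])
  note p = points_TA_fst[OF P]
  let ?T = "tangent_space TA P"
  have bound: "dim W \<le> DIM('e)" if W: "subspace W" "W \<subseteq> ?T" "\<forall>V\<in>W. V \<noteq> 0 \<longrightarrow> metric_lift P V V < 0" for W
  proof (rule dim_le_DIM)
    show lin: "linear (\<lambda>V. hpart P V c)"
      by (rule linearI) (simp_all add: linear_add[OF linear_hpart] linear_scale[OF linear_hpart])
    \<comment> \<open>A vector with vanishing horizontal part is vertical and therefore isotropic,
      so a negative definite subspace contains none but zero.\<close>
    show "inj_on (\<lambda>V. hpart P V c) W"
      unfolding linear_inj_on_iff_eq_0[OF lin W(1)]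
    proof (intro ballI impI)
      fix V assume V: "V \<in> W" "hpart P V c = 0"
      then have VT: "V \<in> ?T" using W(2) by blast
      have "hpart P V = 0"
        by (rule tangent_eqI[OF hpart_in[OF P VT] subspace_0[OF subspace_tangent_space] c]) (simp add: V)
      then have "metric_lift P V V = 0"
        using P VT p by (simp add: metric_lift_def h_zero vpart_in)
      then show "V = 0" using W(3) V(1) by force
    qed
  qed (rule W(1))
  obtain S where S: "linear S" "\<forall>a. h (fst P) (coord_vec A c (fst P) a) (coord_vec A c (fst P) (S a)) = a \<bullet> a"
    by (rule metric_dual[OF c])
  define g where "g = (\<lambda>a. lift P (coord_vec A c (fst P) a) (coord_vec A c (fst P) (- S a)))"
  have lin: "linear g"
    unfolding g_def by (rule linear_lift_coord[OF linear_ident linear_compose_neg[OF S(1)] c])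
  have sub: "subspace (range g)" by (rule linear_subspace_image[OF lin subspace_UNIV])
  have gT: "range g \<subseteq> ?T" unfolding g_def using P c by (auto intro!: lift_in)
  have neg: "metric_lift P V V < 0" if V: "V \<in> range g" "V \<noteq> 0" for V
  proof -
    obtain a where a: "V = g a" using V(1) by (rule rangeE)
    have "a \<noteq> 0" using a V(2) linear_0[OF lin] by auto
    let ?u = "coord_vec A c (fst P) a" and ?w = "coord_vec A c (fst P) (S a)"
    have in_T: "?u \<in> tangent_space A (fst P)" "?w \<in> tangent_space A (fst P)" using c by simp_all
    have w: "coord_vec A c (fst P) (- S a) = (-1) *\<^sub>R ?w"
      using linear_scale[OF linear_coord_vec[OF c], of "-1" "S a"] by simp
    have "metric_lift P V V = h (fst P) ?u ((-1) *\<^sub>R ?w) + h (fst P) ((-1) *\<^sub>R ?w) ?u"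
      unfolding a g_def w using P in_T
      by (intro metric_lift_lift) (simp_all add: subspace_neg[OF subspace_tangent_space])
    also have "\<dots> = - 2 * (a \<bullet> a)"
      using h_scale[OF p in_T(2) in_T(1), of "-1"]
        h_sym[OF p in_T] spec[OF S(2), of a] by simp
    also have "\<dots> < 0" using \<open>a \<noteq> 0\<close> by simp
    finally show ?thesis .
  qed
  have dim: "dim (range g) = DIM('e)"
    unfolding g_def by (rule dim_range[OF lin[unfolded g_def] inj_lift_coord[OF P c]])
  show ?thesis
    unfolding metric_index_def
  proof (rule Max_eqI)
    \<comment> \<open>The index is a \<open>Max\<close>, which is meaningful only for a finite set;
      the dimension bound supplies finiteness as well as maximality.\<close>
    show "finite {dim W |W. subspace W \<and> W \<subseteq> ?T \<and> (\<forall>v\<in>W. v \<noteq> 0 \<longrightarrow> metric_lift P v v < 0)}"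
      by (rule finite_subset[of _ "{..DIM('e)}"]) (use bound in auto)
    show "DIM('e) \<in> {dim W |W. subspace W \<and> W \<subseteq> ?T \<and> (\<forall>v\<in>W. v \<noteq> 0 \<longrightarrow> metric_lift P v v < 0)}"
      using sub gT neg dim by (intro CollectI exI[of _ "range g"]) simp
  qed (use bound in auto)
qed

lemma pseudo_riemannian_lift: "pseudo_riemannian_manifold TA metric_lift"
  unfolding pseudo_riemannian_manifold_def
proof (intro conjI ballI impI exI)
  show "smooth_manifold TA"
    using metric smooth_manifold_TA by (simp add: pseudo_riemannian_manifold_def)
  show "tensor_field_02 TA metric_lift" by (rule tensor_field_metric_lift)
  fix P assume P: "P \<in> points TA"
  note p = points_TA_fst[OF P]
  show "metric_index TA metric_lift P = DIM('e)" by (rule metric_index_lift[OF P])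
  fix V assume V: "V \<in> tangent_space TA P"
  note Vp = hpart_in[OF P V] vpart_in[OF P V]
  note 0 = subspace_0[OF subspace_tangent_space[of "fst P"]]
  show "metric_lift P V W = metric_lift P W V" if W: "W \<in> tangent_space TA P" for W
    using P V W h_sym[OF p] Vp hpart_in[OF P W] vpart_in[OF P W] by (simp add: metric_lift_def)
  assume *: "\<forall>W\<in>tangent_space TA P. metric_lift P V W = 0"
  \<comment> \<open>Pairing with vertical vectors isolates the horizontal part of \<open>V\<close>,
    and pairing with horizontal vectors isolates the vertical part. Nondegeneracy of
    \<open>h\<close> then kills each.\<close>
  have "h (fst P) (hpart P V) w = 0" if w: "w \<in> tangent_space A (fst P)" for w
    using bspec[OF * lift_in[OF P 0 w]] P V w Vp 0 p by (simp add: metric_lift_def lift_in h_zero)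
  then have hV: "hpart P V = 0" by (rule h_nondegenerate[OF p Vp(1)])
  have "h (fst P) (vpart P V) u = 0" if u: "u \<in> tangent_space A (fst P)" for u
    using bspec[OF * lift_in[OF P u 0]] P V u Vp 0 p by (simp add: metric_lift_def lift_in h_zero)
  then have vV: "vpart P V = 0" by (rule h_nondegenerate[OF p Vp(2)])
  show "V = 0"
    using lift_parts[OF P V] lift_scale[of P 0 0 0] by (simp add: hV vV)
qed

text \<open>On pairs \<open>(u, w)\<close> and \<open>(u', w')\<close> both sides equal
  \<open>s h(w, w') + h(u, u')\<close>.\<close>

lemma metric_symmetric_lift_endo: "metric_symmetric TA (lift_endo s) metric_lift"
  unfolding metric_symmetric_def
proof (intro ballI)
  fix P V W assume P: "P \<in> points TA" and V: "V \<in> tangent_space TA P" and W: "W \<in> tangent_space TA P"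
  note p = points_TA_fst[OF P]
  note in_T = hpart_in[OF P V] vpart_in[OF P V] hpart_in[OF P W] vpart_in[OF P W]
  show "metric_lift P (lift_endo s P V) W = metric_lift P V (lift_endo s P W)"
    using P V W in_T h_scale[OF p]
    by (simp add: metric_lift_def lift_endo_in parts_lift_endo)
qed

text \<open>The condition \<open>(w, u) = s (u, w)\<close> amounts to \<open>w = s u\<close> because
  \<open>s * s = 1\<close>. The eigenspace is therefore the graph of multiplication by
  \<open>s\<close>, parametrized by the coordinates of \<open>u\<close>.\<close>

lemma eigenspace_lift_endo:
  assumes P: "P \<in> points TA" and s: "s = 1 \<or> s = -1"
  shows "dim {V \<in> tangent_space TA P. lift_endo 1 P V = s *\<^sub>R V} = DIM('e)"
proof -
  obtain c where c: "c \<in> charts_at A (fst P)" by (rule chart_below[OF P])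
  let ?g = "\<lambda>a. lift P (coord_vec A c (fst P) a) (coord_vec A c (fst P) (s *\<^sub>R a))"
  have lin: "linear ?g"
    by (rule linear_lift_coord[OF linear_ident linear_scale_self c])
  have cs: "coord_vec A c (fst P) (s *\<^sub>R a) = s *\<^sub>R coord_vec A c (fst P) a" for a
    by (rule linear_scale[OF linear_coord_vec[OF c]])
  have ss: "s * s = 1" using s by auto
  have "{V \<in> tangent_space TA P. lift_endo 1 P V = s *\<^sub>R V} = range ?g"
  proof (intro equalityI subsetI)
    fix V assume "V \<in> {V \<in> tangent_space TA P. lift_endo 1 P V = s *\<^sub>R V}"
    then have V: "V \<in> tangent_space TA P" and eq: "lift_endo 1 P V = s *\<^sub>R V" by simp_all
    have "vpart P (lift_endo 1 P V) = s *\<^sub>R vpart P V"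
      unfolding eq by (rule linear_scale[OF linear_vpart])
    then have "s *\<^sub>R hpart P V = s *\<^sub>R s *\<^sub>R vpart P V" by (simp only: parts_lift_endo[OF P V])
    then have "vpart P V = s *\<^sub>R hpart P V" by (simp only: scaleR_scaleR ss scaleR_one)
    then have "V = ?g (hpart P V c)"
      using lift_parts[OF P V] hpart_in[OF P V] c by (simp add: cs)
    then show "V \<in> range ?g" by (rule range_eqI)
  next
    fix V assume "V \<in> range ?g"
    then obtain a where a: "V = ?g a" by (rule rangeE)
    let ?u = "coord_vec A c (fst P) a"
    have u: "?u \<in> tangent_space A (fst P)" using c by simp
    have su: "s *\<^sub>R ?u \<in> tangent_space A (fst P)" by (rule subspace_scale[OF subspace_tangent_space u])
    have V: "V \<in> tangent_space TA P" unfolding a cs by (rule lift_in[OF P u su])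
    have "lift_endo 1 P V = lift P (s *\<^sub>R ?u) ?u"
      using P V u su unfolding a cs by (simp add: lift_endo_def)
    also have "\<dots> = lift P (s *\<^sub>R ?u) (s *\<^sub>R s *\<^sub>R ?u)" by (simp only: scaleR_scaleR ss scaleR_one)
    also have "\<dots> = s *\<^sub>R V" unfolding a cs by (rule lift_scale)
    finally show "V \<in> {V \<in> tangent_space TA P. lift_endo 1 P V = s *\<^sub>R V}" using V by simp
  qed
  then show ?thesis using dim_range[OF lin inj_lift_coord[OF P c]] by simp
qed

lemma norden_lift: "norden_manifold TA (lift_endo (-1)) metric_lift"
  unfolding norden_manifold_def almost_complex_manifold_def
  using pseudo_riemannian_lift metric_symmetric_lift_endo tensor_field_lift_endo
  by (simp add: lift_endo_twice pseudo_riemannian_manifold_def)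

lemma para_norden_lift: "almost_para_norden_manifold TA (lift_endo 1) metric_lift"
  unfolding almost_para_norden_manifold_def
  using pseudo_riemannian_lift metric_symmetric_lift_endo tensor_field_lift_endo
    eigenspace_lift_endo[of _ 1] eigenspace_lift_endo[of _ "-1"]
  by (simp add: lift_endo_twice)

end

theorem proposition5p5:
  fixes M :: "('a, 'e::euclidean_space) chart set"
    and h :: "'a \<Rightarrow> ('a, 'e) tvec \<Rightarrow> ('a, 'e) tvec \<Rightarrow> real"
    and nabla :: "('a \<Rightarrow> ('a, 'e) tvec) \<Rightarrow> ('a \<Rightarrow> ('a, 'e) tvec) \<Rightarrow> ('a \<Rightarrow> ('a, 'e) tvec)"
  assumes "pseudo_riemannian_manifold M h"
    and "affine_connection M nabla"
  shows "norden_manifold (tangent_bundle M) (Jbar_minus M nabla) (hlift_metric M nabla h) \<and>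
    almost_para_norden_manifold (tangent_bundle M) (Jbar_plus M nabla) (hlift_metric M nabla h)"
proof -
  interpret lifted_metric M nabla h
    using assms by unfold_locales (simp_all add: pseudo_riemannian_manifold_def smooth_manifold_def)
  show ?thesis
    unfolding lift_structure_eq hlift_metric_eq using norden_lift para_norden_lift by (rule conjI)
qed

end
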